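(* Let $d\ge 1$ and $0<\mu<4d$. There exist a finite length $L_\#(\mu)$ and a finite coupling constant $U_\#(\mu)\ge 0$ such that for all even integers $L\ge L_\#(\mu)$ and all $U\ge U_\#(\mu)$ the minimal HFz energy on $\Lambda=\mathbb{Z}_L^d$ equals the sum of the negative eigenvalues of $-\Delta-\mu$: $$E^{(\mathrm{hfz})}_{\mu,U}=\mathrm{Tr}\{[-\Delta-\mu]_-\}.$$ Moreover, if $\mu$ is not an eigenvalue of $-\Delta$ and $(\gamma_\uparrow,\gamma_\downarrow)$ is a minimizer of the HFz functional (i.e. $0\le\gamma_{\uparrow},\gamma_\downarrow\le 1$ and $\mathcal{E}^{(\mathrm{hfz})}_{\mu,U}(\gamma_\uparrow,\gamma_\downarrow)=E^{(\mathrm{hfz})}_{\mu,U}$), then either $\gamma_\uparrow=\mathbb{1}[-\Delta<\mu]$ and $\gamma_\downarrow=0$, or $\gamma_\uparrow=0$ and $\gamma_\downarrow=\mathbb{1}[-\Delta<\mu]$, where $\mathbb{1}[-\Delta<\mu]$ is the spectral projection of $-\Delta$ onto $(-\infty,\mu)$.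
   Context: $\Lambda=\mathbb{Z}_L^d=(\mathbb{Z}/L\mathbb{Z})^d$ is the periodic cubic lattice with $L$ even. For $x,y\in\Lambda$, $|x-y|_1$ is the (periodic) $\ell^1$ lattice distance. The nearest-neighbour hopping matrix is $T_{x,y}=1$ if $|x-y|_1=1$ and $0$ otherwise; the discrete Laplacian is $\Delta_{x,y}=T_{x,y}-2d\,\delta_{x,y}$ (so $-\Delta\ge 0$). Set $K_\mu=-\Delta-\mu$. For a self-adjoint matrix $X$, $[X]_-=\min\{X,0\}$ (negative part, a nonpositive matrix), so $\mathrm{Tr}[X]_-$ is the sum of the negative eigenvalues of $X$; $\mathrm{Tr}$ is the trace on $\mathbb{C}^\Lambda$. A one-particle density matrix is a Hermitian $\Lambda\times\Lambda$ matrix $\gamma$ with $0\le\gamma\le1$. The HFz functional is $\mathcal{E}^{(\mathrm{hfz})}_{\mu,U}(\gamma_\uparrow,\gamma_\downarrow)=\mathrm{Tr}\{K_\mu(\gamma_\uparrow+\gamma_\downarrow)\}+U\sum_{x\in\Lambda}\rho_\uparrow(x)\rho_\downarrow(x)$, with $\rho_\sigma(x)=(\gamma_\sigma)_{x,x}$, and $E^{(\mathrm{hfz})}_{\mu,U}=\min\{\mathcal{E}^{(\mathrm{hfz})}_{\mu,U}(\gamma_\uparrow,\gamma_\downarrow): 0\le\gamma_\uparrow,\gamma_\downarrow\le1\}$. *)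

theory Defs
  imports Complex_Main
begin

text \<open>Sites of the lattice are functions nat \<Rightarrow> nat; the torus (Z/LZ)^d is the
  finite carrier of all x with x i < L for i < d and x i = 0 for i \<ge> d.
  Matrices are functions site \<Rightarrow> site \<Rightarrow> complex, vectors site \<Rightarrow> complex;
  all linear algebra is relative to the finite carrier.\<close>

type_synonym site = "nat \<Rightarrow> nat"
type_synonym cvec = "site \<Rightarrow> complex"
type_synonym cmat = "site \<Rightarrow> site \<Rightarrow> complex"

definition lattice :: "nat \<Rightarrow> nat \<Rightarrow> site set" where
  "lattice d L = {x. (\<forall>i<d. x i < L) \<and> (\<forall>i. d \<le> i \<longrightarrow> x i = 0)}"

definition cdist :: "nat \<Rightarrow> nat \<Rightarrow> nat \<Rightarrow> int" where
  "cdist L a b = min ((int a - int b) mod int L) ((int b - int a) mod int L)"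

definition dist1 :: "nat \<Rightarrow> nat \<Rightarrow> site \<Rightarrow> site \<Rightarrow> int" where
  "dist1 d L x y = (\<Sum>i<d. cdist L (x i) (y i))"

definition on_sites :: "site set \<Rightarrow> cmat \<Rightarrow> bool" where
  "on_sites \<Lambda> A \<longleftrightarrow> (\<forall>x y. x \<notin> \<Lambda> \<or> y \<notin> \<Lambda> \<longrightarrow> A x y = 0)"

definition supported :: "site set \<Rightarrow> cvec \<Rightarrow> bool" where
  "supported \<Lambda> v \<longleftrightarrow> (\<forall>x. x \<notin> \<Lambda> \<longrightarrow> v x = 0)"

definition idm :: "site set \<Rightarrow> cmat" where
  "idm \<Lambda> x y = (if x \<in> \<Lambda> \<and> y \<in> \<Lambda> \<and> x = y then 1 else 0)"

definition mmul :: "site set \<Rightarrow> cmat \<Rightarrow> cmat \<Rightarrow> cmat" where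
  "mmul \<Lambda> A B x y = (\<Sum>z\<in>\<Lambda>. A x z * B z y)"

definition mvec :: "site set \<Rightarrow> cmat \<Rightarrow> cvec \<Rightarrow> cvec" where
  "mvec \<Lambda> A v x = (\<Sum>y\<in>\<Lambda>. A x y * v y)"

definition mtrace :: "site set \<Rightarrow> cmat \<Rightarrow> complex" where
  "mtrace \<Lambda> A = (\<Sum>x\<in>\<Lambda>. A x x)"

definition hermitian :: "site set \<Rightarrow> cmat \<Rightarrow> bool" where
  "hermitian \<Lambda> A \<longleftrightarrow> on_sites \<Lambda> A \<and> (\<forall>x y. A y x = cnj (A x y))"

definition psd :: "site set \<Rightarrow> cmat \<Rightarrow> bool" where
  "psd \<Lambda> A \<longleftrightarrow> hermitian \<Lambda> A \<and>
     (\<forall>v. 0 \<le> Re (\<Sum>x\<in>\<Lambda>. cnj (v x) * mvec \<Lambda> A v x))"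

definition density_matrix :: "site set \<Rightarrow> cmat \<Rightarrow> bool" where
  "density_matrix \<Lambda> \<gamma> \<longleftrightarrow> psd \<Lambda> \<gamma> \<and> psd \<Lambda> (\<lambda>x y. idm \<Lambda> x y - \<gamma> x y)"

definition hopping :: "nat \<Rightarrow> nat \<Rightarrow> cmat" where
  "hopping d L x y =
     (if x \<in> lattice d L \<and> y \<in> lattice d L \<and> dist1 d L x y = 1 then 1 else 0)"

definition laplacian :: "nat \<Rightarrow> nat \<Rightarrow> cmat" where
  "laplacian d L x y = hopping d L x y - 2 * of_nat d * idm (lattice d L) x y"

definition Kmu :: "nat \<Rightarrow> nat \<Rightarrow> real \<Rightarrow> cmat" where
  "Kmu d L \<mu> x y = - laplacian d L x y - of_real \<mu> * idm (lattice d L) x y"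

definition eigvec :: "site set \<Rightarrow> cmat \<Rightarrow> real \<Rightarrow> cvec \<Rightarrow> bool" where
  "eigvec \<Lambda> A l w \<longleftrightarrow> supported \<Lambda> w \<and> w \<noteq> (\<lambda>_. 0) \<and>
     mvec \<Lambda> A w = (\<lambda>x. of_real l * w x)"

definition is_eigenvalue :: "site set \<Rightarrow> cmat \<Rightarrow> real \<Rightarrow> bool" where
  "is_eigenvalue \<Lambda> A l \<longleftrightarrow> (\<exists>w. eigvec \<Lambda> A l w)"

definition span_below :: "site set \<Rightarrow> cmat \<Rightarrow> real \<Rightarrow> cvec set" where
  "span_below \<Lambda> A c = {v. \<exists>ps :: (real \<times> cvec) list.
      (\<forall>(l, w) \<in> set ps. l < c \<and> eigvec \<Lambda> A l w) \<and>
      v = (\<lambda>x. \<Sum>(l, w) \<leftarrow> ps. w x)}"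

definition orth_proj_onto :: "site set \<Rightarrow> cmat \<Rightarrow> cvec set \<Rightarrow> bool" where
  "orth_proj_onto \<Lambda> P S \<longleftrightarrow> hermitian \<Lambda> P \<and> mmul \<Lambda> P P = P \<and>
     {mvec \<Lambda> P v | v. supported \<Lambda> v} = S"

definition spec_proj_below :: "site set \<Rightarrow> cmat \<Rightarrow> real \<Rightarrow> cmat" where
  "spec_proj_below \<Lambda> A c = (THE P. orth_proj_onto \<Lambda> P (span_below \<Lambda> A c))"

definition neg_part :: "site set \<Rightarrow> cmat \<Rightarrow> cmat" where
  "neg_part \<Lambda> X = mmul \<Lambda> X (spec_proj_below \<Lambda> X 0)"

definition trace_neg :: "site set \<Rightarrow> cmat \<Rightarrow> real" where
  "trace_neg \<Lambda> X = Re (mtrace \<Lambda> (neg_part \<Lambda> X))"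

text \<open>HFz functional (the trace is real for Hermitian arguments)\<close>
definition hfz :: "nat \<Rightarrow> nat \<Rightarrow> real \<Rightarrow> real \<Rightarrow> cmat \<Rightarrow> cmat \<Rightarrow> real" where
  "hfz d L \<mu> U gu gd =
     Re (mtrace (lattice d L) (mmul (lattice d L) (Kmu d L \<mu>) (\<lambda>x y. gu x y + gd x y)))
     + U * (\<Sum>x\<in>lattice d L. Re (gu x x) * Re (gd x x))"

definition E_hfz :: "nat \<Rightarrow> nat \<Rightarrow> real \<Rightarrow> real \<Rightarrow> real" where
  "E_hfz d L \<mu> U = Inf {hfz d L \<mu> U gu gd | gu gd.
      density_matrix (lattice d L) gu \<and> density_matrix (lattice d L) gd}"

end

theory Submission
  imports Defs
begin

text \<open>
  Let \<open>A\<close> be the sites where spin up dominates, \<open>B\<close> those where spin down dominates, both with density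
  at least a small \<open>\<eta>\<close>, and \<open>E\<close> the remaining sites. Since plane waves are flat, a density matrix
  cut off to \<open>A\<close> has energy at least \<open>|A|/|\<Lambda>| Tr[K]\<^sub>-\<close>, with an excess that controls the blocks of the
  indicator \<open>1\<^sub>A\<close> between momenta well below and well above the Fermi level. A momentum transfer \<open>q\<close>
  bounded away from zero is realised by a positive fraction of such pairs, uniformly in \<open>L\<close>, and
  indicator functions carry a positive fraction of their boundary on such \<open>q\<close>; hence the excess is at
  least a constant times the size of the boundary of \<open>A\<close>. For large \<open>U\<close> the leakage of spin up out
  of \<open>A\<close> gains less than this boundary energy, and leakage into \<open>E\<close> gains less than the bulk
  energy lost there. So the energy is at least \<open>Tr[K]\<^sub>-\<close>, and equality forces \<open>E\<close> and all
  boundaries to be empty, that is, one spin species occupies the whole torus and the other vanishes.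
\<close>

section \<open>Quadratic forms and density matrices\<close>

text \<open>The difficulty is that \<open>U\<close> must be finite and independent of
  \<open>L\<close>. On a site where a species has density r and a neighbours in its own region,
  leakage gains up to 2 a sqrt(r) + \<mu> r, whereas the repulsion costs only a multiple of r; for
  small r no finite repulsion wins on its own. Completing the square leaves a remainder a^2/W, where
  W may be taken large if \<open>U\<close> is large. As a <= 2 d, these remainders add up to a
  multiple of the boundary divided by W, which is why a surface energy uniform in \<open>L\<close>
  is wanted. On \<open>E\<close> there is no repulsion to rely on, but both densities are below
  \<eta> there. Order of the constants: \<delta> is the distance of \<mu> to the band edges 0 and 4
  d, capped at 1/2; \<rho> is the relative size of a momentum box on which the dispersion moves by
  at most \<delta>/2; c is the resulting surface tension; \<eta> keeps leakage into \<open>E\<close>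
  below half of the bulk bound; \<open>U\<close> comes last, since the repulsion has to act against
  a density of only \<eta>. \<open>L\<close> enters only through its parity, L >= 3 and \<rho> L >=
  1.\<close>

definition ip :: "site set \<Rightarrow> cvec \<Rightarrow> cvec \<Rightarrow> complex" where
  "ip \<Lambda> v w = (\<Sum>x\<in>\<Lambda>. cnj (v x) * w x)"

lemma ip_add_right: "ip \<Lambda> v (\<lambda>x. w x + w' x) = ip \<Lambda> v w + ip \<Lambda> v w'"
  by (simp add: ip_def algebra_simps sum.distrib)

lemma ip_diff_right: "ip \<Lambda> v (\<lambda>x. w x - w' x) = ip \<Lambda> v w - ip \<Lambda> v w'"
  by (simp add: ip_def algebra_simps sum_subtractf)

lemma ip_scale_right: "ip \<Lambda> v (\<lambda>x. c * w x) = c * ip \<Lambda> v w"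
  by (simp add: ip_def algebra_simps sum_distrib_left)

lemma ip_add_left: "ip \<Lambda> (\<lambda>x. w x + w' x) v = ip \<Lambda> w v + ip \<Lambda> w' v"
  by (simp add: ip_def algebra_simps sum.distrib)

lemma ip_scale_left: "ip \<Lambda> (\<lambda>x. c * w x) v = cnj c * ip \<Lambda> w v"
  by (simp add: ip_def algebra_simps sum_distrib_left)

lemma ip_commute: "ip \<Lambda> v w = cnj (ip \<Lambda> w v)"
  by (simp add: ip_def mult.commute)

lemma ip_self: "ip \<Lambda> v v = of_real (\<Sum>x\<in>\<Lambda>. (cmod (v x))\<^sup>2)"
  unfolding ip_def of_real_sum
  by (intro sum.cong refl) (metis complex_norm_square mult.commute of_real_power)

lemma mvec_add: "mvec \<Lambda> A (\<lambda>x. v x + w x) = (\<lambda>x. mvec \<Lambda> A v x + mvec \<Lambda> A w x)"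
  by (rule ext) (simp add: mvec_def algebra_simps sum.distrib)

lemma mvec_scale: "mvec \<Lambda> A (\<lambda>x. c * v x) = (\<lambda>x. c * mvec \<Lambda> A v x)"
  by (rule ext) (simp add: mvec_def algebra_simps sum_distrib_left)

lemma mvec_diff_mat:
  "mvec \<Lambda> (\<lambda>x y. A x y - B x y) v = (\<lambda>x. mvec \<Lambda> A v x - mvec \<Lambda> B v x)"
  by (rule ext) (simp add: mvec_def algebra_simps sum_subtractf)

lemma mvec_mmul: "mvec \<Lambda> (mmul \<Lambda> A B) v = mvec \<Lambda> A (mvec \<Lambda> B v)"
proof
  fix x
  have "mvec \<Lambda> (mmul \<Lambda> A B) v x = (\<Sum>y\<in>\<Lambda>. \<Sum>z\<in>\<Lambda>. A x z * B z y * v y)"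
    by (simp add: mvec_def mmul_def sum_distrib_right)
  also have "\<dots> = (\<Sum>z\<in>\<Lambda>. \<Sum>y\<in>\<Lambda>. A x z * B z y * v y)"
    by (rule sum.swap)
  also have "\<dots> = mvec \<Lambda> A (mvec \<Lambda> B v) x"
    by (simp add: mvec_def sum_distrib_left mult.assoc)
  finally show "mvec \<Lambda> (mmul \<Lambda> A B) v x = mvec \<Lambda> A (mvec \<Lambda> B v) x" .
qed

lemma mvec_delta:
  assumes "finite \<Lambda>" "y \<in> \<Lambda>"
  shows "mvec \<Lambda> A (\<lambda>x. of_bool (x = y)) = (\<lambda>x. A x y)"
proof
  fix x
  have "mvec \<Lambda> A (\<lambda>x. of_bool (x = y)) x = (\<Sum>z\<in>\<Lambda>. if z = y then A x z else 0)"
    unfolding mvec_def by (intro sum.cong) auto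
  then show "mvec \<Lambda> A (\<lambda>x. of_bool (x = y)) x = A x y" using assms by simp
qed

lemma ip_delta_left:
  assumes "finite \<Lambda>" "y \<in> \<Lambda>"
  shows "ip \<Lambda> (\<lambda>x. of_bool (x = y)) v = v y"
proof -
  have "ip \<Lambda> (\<lambda>x. of_bool (x = y)) v = (\<Sum>x\<in>\<Lambda>. if x = y then v x else 0)"
    unfolding ip_def by (intro sum.cong) auto
  then show ?thesis using assms by simp
qed

lemma mtrace_mmul_commute: "mtrace \<Lambda> (mmul \<Lambda> A B) = mtrace \<Lambda> (mmul \<Lambda> B A)"
  unfolding mtrace_def mmul_def by (subst sum.swap) (simp add: mult.commute)

lemma hermitianI:
  assumes "\<And>x y. x \<notin> \<Lambda> \<or> y \<notin> \<Lambda> \<Longrightarrow> A x y = 0" "\<And>x y. A y x = cnj (A x y)"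
  shows "hermitian \<Lambda> A"
  using assms unfolding hermitian_def on_sites_def by metis

lemma hermitian_cnj: "hermitian \<Lambda> A \<Longrightarrow> cnj (A x y) = A y x"
  unfolding hermitian_def by metis

lemma hermitian_outside: "hermitian \<Lambda> A \<Longrightarrow> x \<notin> \<Lambda> \<or> y \<notin> \<Lambda> \<Longrightarrow> A x y = 0"
  unfolding hermitian_def on_sites_def by blast

lemma hermitian_ip:
  assumes "hermitian \<Lambda> A"
  shows "ip \<Lambda> v (mvec \<Lambda> A w) = cnj (ip \<Lambda> w (mvec \<Lambda> A v))"
proof -
  have h: "cnj (A x y) = A y x" for x y
    by (rule hermitian_cnj[OF assms])
  have "cnj (ip \<Lambda> w (mvec \<Lambda> A v)) = (\<Sum>x\<in>\<Lambda>. \<Sum>y\<in>\<Lambda>. w x * (A y x * cnj (v y)))"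
    by (simp add: ip_def mvec_def sum_distrib_left h)
  also have "\<dots> = (\<Sum>y\<in>\<Lambda>. \<Sum>x\<in>\<Lambda>. w x * (A y x * cnj (v y)))"
    by (rule sum.swap)
  also have "\<dots> = ip \<Lambda> v (mvec \<Lambda> A w)"
    by (simp add: ip_def mvec_def sum_distrib_left algebra_simps)
  finally show ?thesis by simp
qed

definition qf :: "site set \<Rightarrow> cmat \<Rightarrow> cvec \<Rightarrow> real" where
  "qf \<Lambda> A v = Re (ip \<Lambda> v (mvec \<Lambda> A v))"

lemma psd_iff: "psd \<Lambda> A \<longleftrightarrow> hermitian \<Lambda> A \<and> (\<forall>v. 0 \<le> qf \<Lambda> A v)"
  by (simp add: psd_def qf_def ip_def)

lemma qf_hermitian:
  assumes "hermitian \<Lambda> A"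
  shows "ip \<Lambda> v (mvec \<Lambda> A v) = of_real (qf \<Lambda> A v)"
proof -
  have "Im (ip \<Lambda> v (mvec \<Lambda> A v)) = - Im (ip \<Lambda> v (mvec \<Lambda> A v))"
    using hermitian_ip[OF assms, of v v] by (metis cnj.simps(2))
  then have "Im (ip \<Lambda> v (mvec \<Lambda> A v)) = 0" by linarith
  then show ?thesis by (simp add: qf_def complex_eq_iff)
qed

text \<open>The form is evaluated at \<open>v - s * cnj b * w\<close>, where
  \<open>b = ip \<Lambda> v (mvec \<Lambda> A w)\<close>; this choice of phase makes both cross
  terms real, and s is then optimised. As A is only semidefinite,
  \<open>qf \<Lambda> A w = 0\<close> is treated apart: an affine function of s that is nonnegative
  everywhere has slope zero.\<close>

lemma psd_cauchy_schwarz: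
  assumes "psd \<Lambda> A"
  shows "(cmod (ip \<Lambda> v (mvec \<Lambda> A w)))\<^sup>2 \<le> qf \<Lambda> A v * qf \<Lambda> A w"
proof -
  have herm: "hermitian \<Lambda> A" and pos: "\<And>v. 0 \<le> qf \<Lambda> A v"
    using assms by (auto simp: psd_iff)
  define b where "b = ip \<Lambda> v (mvec \<Lambda> A w)"
  have b': "ip \<Lambda> w (mvec \<Lambda> A v) = cnj b"
    unfolding b_def by (rule hermitian_ip[OF herm])
  define N where "N = (cmod b)\<^sup>2"
  have N: "b * cnj b = of_real N" "cnj b * b = of_real N"
    unfolding N_def using complex_norm_square[of b] by (simp_all add: mult.commute)
  have key: "0 \<le> qf \<Lambda> A v - 2 * s * N + s\<^sup>2 * N * qf \<Lambda> A w" for s :: real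
  proof -
    define z where "z = - (of_real s * cnj b)"
    have "ip \<Lambda> (\<lambda>x. v x + z * w x) (mvec \<Lambda> A (\<lambda>x. v x + z * w x))
        = ip \<Lambda> v (mvec \<Lambda> A v) + z * b + cnj z * cnj b + cnj z * z * ip \<Lambda> w (mvec \<Lambda> A w)"
      by (simp add: mvec_add mvec_scale ip_add_left ip_add_right ip_scale_left
          ip_scale_right b_def[symmetric] b' algebra_simps)
    also have "z * b = - of_real (s * N)"
      by (simp add: z_def N mult.assoc)
    also have "cnj z * cnj b = - of_real (s * N)"
      by (simp add: z_def N mult.assoc)
    also have "cnj z * z = of_real (s\<^sup>2 * N)"
      by (simp add: z_def N(1)[symmetric] power2_eq_square)
    finally have "complex_of_real (qf \<Lambda> A (\<lambda>x. v x + z * w x))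
        = of_real (qf \<Lambda> A v - 2 * s * N + s\<^sup>2 * N * qf \<Lambda> A w)"
      unfolding qf_hermitian[OF herm] by simp
    then have "qf \<Lambda> A (\<lambda>x. v x + z * w x) = qf \<Lambda> A v - 2 * s * N + s\<^sup>2 * N * qf \<Lambda> A w"
      by (simp only: of_real_eq_iff)
    then show ?thesis using pos by metis
  qed
  have "N \<le> qf \<Lambda> A v * qf \<Lambda> A w"
  proof (cases "qf \<Lambda> A w = 0")
    case True
    have "N = 0"
    proof (rule ccontr)
      assume "N \<noteq> 0"
      then have "N > 0" by (simp add: N_def)
      have "0 \<le> qf \<Lambda> A v - 2 * ((qf \<Lambda> A v + 1) / (2 * N)) * N"
        using key[of "(qf \<Lambda> A v + 1) / (2 * N)"] True by simp
      then show False using \<open>N > 0\<close> by simp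
    qed
    then show ?thesis using True by simp
  next
    case False
    then have c: "qf \<Lambda> A w > 0" using pos[of w] by simp
    have "0 \<le> qf \<Lambda> A v - N / qf \<Lambda> A w"
      using key[of "1 / qf \<Lambda> A w"] c by (simp add: power2_eq_square)
    then show ?thesis using c by (simp add: field_simps)
  qed
  then show ?thesis by (simp add: N_def b_def)
qed

lemma mvec_idm:
  assumes "finite \<Lambda>"
  shows "mvec \<Lambda> (idm \<Lambda>) v = (\<lambda>x. if x \<in> \<Lambda> then v x else 0)"
proof
  fix x
  have "mvec \<Lambda> (idm \<Lambda>) v x = (\<Sum>y\<in>\<Lambda>. if y = x then v x else 0)"
    unfolding mvec_def idm_def by (intro sum.cong) auto
  then show "mvec \<Lambda> (idm \<Lambda>) v x = (if x \<in> \<Lambda> then v x else 0)"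
    using assms by simp
qed

lemma qf_diff: "qf \<Lambda> (\<lambda>x y. A x y - B x y) v = qf \<Lambda> A v - qf \<Lambda> B v"
  by (simp add: qf_def mvec_diff_mat ip_diff_right)

lemma qf_idm:
  assumes "finite \<Lambda>"
  shows "qf \<Lambda> (idm \<Lambda>) v = (\<Sum>x\<in>\<Lambda>. (cmod (v x))\<^sup>2)"
proof -
  have "ip \<Lambda> v (\<lambda>x. if x \<in> \<Lambda> then v x else 0) = ip \<Lambda> v v"
    unfolding ip_def by (intro sum.cong) auto
  then show ?thesis by (simp add: qf_def mvec_idm[OF assms] ip_self)
qed

lemma density_matrix_iff:
  assumes "finite \<Lambda>"
  shows "density_matrix \<Lambda> g \<longleftrightarrow> hermitian \<Lambda> g \<and>
    (\<forall>v. 0 \<le> qf \<Lambda> g v \<and> qf \<Lambda> g v \<le> (\<Sum>x\<in>\<Lambda>. (cmod (v x))\<^sup>2))"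
proof -
  have "hermitian \<Lambda> (\<lambda>x y. idm \<Lambda> x y - g x y)" if "hermitian \<Lambda> g"
    by (rule hermitianI)
      (auto simp: hermitian_cnj[OF that] idm_def hermitian_outside[OF that])
  then show ?thesis
    unfolding density_matrix_def psd_iff qf_diff qf_idm[OF assms] by auto
qed

text \<open>This is g^2 <= g for 0 <= g <= 1. With w = g v, Cauchy-Schwarz for the form of g gives
  |w|^4 <= <w, g w> <v, g v> <= |w|^2 <v, g v>. In particular a vector of expectation zero is
  annihilated by g.\<close>

lemma density_matrix_norm_sq:
  assumes fin: "finite \<Lambda>" and g: "density_matrix \<Lambda> g"
  shows "(\<Sum>x\<in>\<Lambda>. (cmod (mvec \<Lambda> g v x))\<^sup>2) \<le> qf \<Lambda> g v"
proof -
  define w where "w = mvec \<Lambda> g v"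
  define N where "N = (\<Sum>x\<in>\<Lambda>. (cmod (w x))\<^sup>2)"
  have N0: "N \<ge> 0" by (simp add: N_def sum_nonneg)
  have qv: "0 \<le> qf \<Lambda> g v" and qw: "qf \<Lambda> g w \<le> N"
    using g by (simp_all add: density_matrix_iff[OF fin] N_def)
  have "(cmod (ip \<Lambda> w (mvec \<Lambda> g v)))\<^sup>2 \<le> qf \<Lambda> g w * qf \<Lambda> g v"
    using g by (intro psd_cauchy_schwarz) (simp add: density_matrix_def)
  also have "ip \<Lambda> w (mvec \<Lambda> g v) = of_real N"
    by (simp add: w_def[symmetric] ip_self N_def)
  finally have "N\<^sup>2 \<le> N * qf \<Lambda> g v"
    using mult_right_mono[OF qw qv] by simp
  then have "N \<le> qf \<Lambda> g v"
    using N0 qv by (cases "N = 0") (auto simp: power2_eq_square)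
  then show ?thesis by (simp add: N_def w_def)
qed

lemma qf_delta:
  assumes "finite \<Lambda>" "y \<in> \<Lambda>"
  shows "qf \<Lambda> A (\<lambda>x. of_bool (x = y)) = Re (A y y)"
  using assms by (simp add: qf_def mvec_delta ip_delta_left)

lemma density_matrix_diag:
  assumes fin: "finite \<Lambda>" and g: "density_matrix \<Lambda> g"
  shows "0 \<le> Re (g y y)" "Re (g y y) \<le> 1"
proof -
  have "0 \<le> Re (g y y) \<and> Re (g y y) \<le> 1"
  proof (cases "y \<in> \<Lambda>")
    case True
    have "(\<Sum>x\<in>\<Lambda>. (cmod (of_bool (x = y)))\<^sup>2) = (\<Sum>x\<in>\<Lambda>. if x = y then 1 else (0::real))"
      by (intro sum.cong) auto
    then have "(\<Sum>x\<in>\<Lambda>. (cmod (of_bool (x = y)))\<^sup>2) = 1"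
      using fin True by simp
    moreover have "0 \<le> qf \<Lambda> g (\<lambda>x. of_bool (x = y)) \<and>
        qf \<Lambda> g (\<lambda>x. of_bool (x = y)) \<le> (\<Sum>x\<in>\<Lambda>. (cmod (of_bool (x = y)))\<^sup>2)"
      using g unfolding density_matrix_iff[OF fin] by blast
    ultimately show ?thesis
      unfolding qf_delta[OF fin True] by simp
  next
    case False
    then have "g y y = 0"
      using g hermitian_outside unfolding density_matrix_iff[OF fin] by blast
    then show ?thesis by simp
  qed
  then show "0 \<le> Re (g y y)" "Re (g y y) \<le> 1" by auto
qed

text \<open>Cauchy-Schwarz for two point masses. The square root is what makes leakage dangerous: a
  small density r at one site still allows an off-diagonal entry of order sqrt(r).\<close>

lemma density_matrix_entry:
  assumes fin: "finite \<Lambda>" and g: "density_matrix \<Lambda> g" and "x \<in> \<Lambda>" "y \<in> \<Lambda>"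
  shows "cmod (g x y) \<le> sqrt (Re (g x x) * Re (g y y))"
proof -
  have "psd \<Lambda> g" using g by (simp add: density_matrix_def)
  from psd_cauchy_schwarz[OF this, of "\<lambda>z. of_bool (z = x)" "\<lambda>z. of_bool (z = y)"]
  have "(cmod (g x y))\<^sup>2 \<le> Re (g x x) * Re (g y y)"
    using assms by (simp add: mvec_delta ip_delta_left qf_delta)
  then show ?thesis by (rule real_le_rsqrt)
qed

lemma density_matrix_zero_diag:
  assumes fin: "finite \<Lambda>" and g: "density_matrix \<Lambda> g" and z: "\<And>x. x \<in> \<Lambda> \<Longrightarrow> Re (g x x) = 0"
  shows "g = (\<lambda>_ _. 0)"
proof (intro ext)
  fix x y
  show "g x y = 0"
  proof (cases "x \<in> \<Lambda> \<and> y \<in> \<Lambda>")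
    case True
    then show ?thesis using density_matrix_entry[OF fin g, of x y] z by simp
  next
    case False
    then show ?thesis
      using g hermitian_outside unfolding density_matrix_iff[OF fin] by blast
  qed
qed

section \<open>Cutting a density matrix off to a set of sites\<close>

definition restr :: "site set \<Rightarrow> cmat \<Rightarrow> cmat" where
  "restr A g x y = (if x \<in> A \<and> y \<in> A then g x y else 0)"

text \<open>Compression by the projection onto A keeps the bounds 0 and 1. The second claim is the
  first one for the hole matrix 1 - g, whose compression is the projection minus the compression of
  g.\<close>

lemma restr_density_matrix:
  assumes fin: "finite \<Lambda>" and g: "density_matrix \<Lambda> g" and "A \<subseteq> \<Lambda>"
  shows "density_matrix \<Lambda> (restr A g)"
    and "density_matrix \<Lambda> (\<lambda>x y. restr A (idm \<Lambda>) x y - restr A g x y)"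
proof -
  have qr: "qf \<Lambda> (restr A h) v = qf \<Lambda> h (\<lambda>x. if x \<in> A then v x else 0)" for h v
    unfolding qf_def ip_def mvec_def restr_def
    by (intro arg_cong[where f=Re] sum.cong) (auto simp: sum_distrib_left intro!: sum.cong)
  have g1: "density_matrix \<Lambda> (\<lambda>x y. idm \<Lambda> x y - g x y)"
    using g unfolding density_matrix_def by simp
  have *: "density_matrix \<Lambda> (restr A h)" if h: "density_matrix \<Lambda> h" for h
    unfolding density_matrix_iff[OF fin] qr
  proof (intro conjI allI)
    show "hermitian \<Lambda> (restr A h)"
    proof -
      have hh: "hermitian \<Lambda> h" using h by (simp add: density_matrix_iff[OF fin])
      show ?thesis
        by (rule hermitianI) (auto simp: restr_def hermitian_cnj[OF hh] hermitian_outside[OF hh])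
    qed
    fix v
    show "0 \<le> qf \<Lambda> h (\<lambda>x. if x \<in> A then v x else 0)"
      using h by (simp add: density_matrix_iff[OF fin])
    have "qf \<Lambda> h (\<lambda>x. if x \<in> A then v x else 0)
        \<le> (\<Sum>x\<in>\<Lambda>. (cmod (if x \<in> A then v x else 0))\<^sup>2)"
      using h by (simp add: density_matrix_iff[OF fin])
    also have "\<dots> \<le> (\<Sum>x\<in>\<Lambda>. (cmod (v x))\<^sup>2)"
      by (intro sum_mono) auto
    finally show "qf \<Lambda> h (\<lambda>x. if x \<in> A then v x else 0) \<le> (\<Sum>x\<in>\<Lambda>. (cmod (v x))\<^sup>2)" .
  qed
  show "density_matrix \<Lambda> (restr A g)" by (rule *[OF g])
  have "restr A (\<lambda>x y. idm \<Lambda> x y - g x y) = (\<lambda>x y. restr A (idm \<Lambda>) x y - restr A g x y)"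
    by (intro ext) (auto simp: restr_def)
  with *[OF g1] show "density_matrix \<Lambda> (\<lambda>x y. restr A (idm \<Lambda>) x y - restr A g x y)" by simp
qed

section \<open>Orthonormal eigenbases and spectral projections\<close>

text \<open>The basis is indexed by the sites themselves, since momenta run through the same finite
  set as positions. Completeness is assumed next to orthonormality, which avoids a dimension
  count.\<close>

locale onb =
  fixes \<Lambda> :: "site set" and u :: "site \<Rightarrow> cvec"
  assumes fin: "finite \<Lambda>"
    and supp: "\<And>k. k \<in> \<Lambda> \<Longrightarrow> supported \<Lambda> (u k)"
    and ortho: "\<And>k l. k \<in> \<Lambda> \<Longrightarrow> l \<in> \<Lambda> \<Longrightarrow> ip \<Lambda> (u k) (u l) = of_bool (k = l)"
    and compl: "\<And>x y. x \<in> \<Lambda> \<Longrightarrow> y \<in> \<Lambda> \<Longrightarrow> (\<Sum>k\<in>\<Lambda>. u k x * cnj (u k y)) = of_bool (x = y)"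
begin

lemma expand:
  assumes "x \<in> \<Lambda>"
  shows "(\<Sum>k\<in>\<Lambda>. u k x * ip \<Lambda> (u k) v) = v x"
proof -
  have "(\<Sum>k\<in>\<Lambda>. u k x * ip \<Lambda> (u k) v) = (\<Sum>k\<in>\<Lambda>. \<Sum>y\<in>\<Lambda>. u k x * cnj (u k y) * v y)"
    by (simp add: ip_def sum_distrib_left mult.assoc)
  also have "\<dots> = (\<Sum>y\<in>\<Lambda>. (\<Sum>k\<in>\<Lambda>. u k x * cnj (u k y)) * v y)"
    by (subst sum.swap) (simp add: sum_distrib_right)
  also have "\<dots> = (\<Sum>y\<in>\<Lambda>. if y = x then v x else 0)"
    by (intro sum.cong) (auto simp: compl assms)
  also have "\<dots> = v x" using assms fin by simp
  finally show ?thesis .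
qed

lemma parseval: "(\<Sum>k\<in>\<Lambda>. (cmod (ip \<Lambda> (u k) v))\<^sup>2) = (\<Sum>x\<in>\<Lambda>. (cmod (v x))\<^sup>2)"
proof -
  have "complex_of_real (\<Sum>k\<in>\<Lambda>. (cmod (ip \<Lambda> (u k) v))\<^sup>2)
      = (\<Sum>k\<in>\<Lambda>. \<Sum>x\<in>\<Lambda>. cnj (v x) * (u k x * ip \<Lambda> (u k) v))"
    unfolding of_real_sum
  proof (intro sum.cong refl)
    fix k
    have "complex_of_real ((cmod (ip \<Lambda> (u k) v))\<^sup>2) = cnj (ip \<Lambda> (u k) v) * ip \<Lambda> (u k) v"
      by (metis complex_norm_square mult.commute of_real_power)
    also have "\<dots> = (\<Sum>x\<in>\<Lambda>. cnj (v x) * (u k x * ip \<Lambda> (u k) v))"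
      unfolding ip_commute[of \<Lambda> "u k" v, symmetric]
      by (subst ip_commute) (simp add: ip_def sum_distrib_right sum_distrib_left algebra_simps)
    finally show "complex_of_real ((cmod (ip \<Lambda> (u k) v))\<^sup>2)
      = (\<Sum>x\<in>\<Lambda>. cnj (v x) * (u k x * ip \<Lambda> (u k) v))" .
  qed
  also have "\<dots> = (\<Sum>x\<in>\<Lambda>. cnj (v x) * (\<Sum>k\<in>\<Lambda>. u k x * ip \<Lambda> (u k) v))"
    by (subst sum.swap) (simp add: sum_distrib_left)
  also have "\<dots> = ip \<Lambda> v v"
    unfolding ip_def by (intro sum.cong) (auto simp: expand[unfolded ip_def])
  finally show ?thesis by (simp add: ip_self flip: of_real_sum)
qed

lemma mtrace_onb: "mtrace \<Lambda> B = (\<Sum>k\<in>\<Lambda>. ip \<Lambda> (u k) (mvec \<Lambda> B (u k)))"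
proof -
  have "(\<Sum>k\<in>\<Lambda>. ip \<Lambda> (u k) (mvec \<Lambda> B (u k)))
      = (\<Sum>k\<in>\<Lambda>. \<Sum>x\<in>\<Lambda>. \<Sum>y\<in>\<Lambda>. B x y * (u k y * cnj (u k x)))"
    by (simp add: ip_def mvec_def sum_distrib_left algebra_simps)
  also have "\<dots> = (\<Sum>x\<in>\<Lambda>. \<Sum>y\<in>\<Lambda>. \<Sum>k\<in>\<Lambda>. B x y * (u k y * cnj (u k x)))"
    by (subst sum.swap) (intro sum.cong refl sum.swap)
  also have "\<dots> = (\<Sum>x\<in>\<Lambda>. \<Sum>y\<in>\<Lambda>. if y = x then B x x else 0)"
    by (intro sum.cong refl) (auto simp: compl simp flip: sum_distrib_left)
  also have "\<dots> = mtrace \<Lambda> B" using fin by (simp add: mtrace_def)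
  finally show ?thesis by simp
qed

text \<open>By completeness, summing \<open>mvec \<Lambda> A (u k) x * cnj (u k y)\<close> over k
  returns the entry \<open>A x y\<close>.\<close>

lemma mat_eqI:
  assumes A: "on_sites \<Lambda> A" and B: "on_sites \<Lambda> B"
    and eq: "\<And>k x. k \<in> \<Lambda> \<Longrightarrow> x \<in> \<Lambda> \<Longrightarrow> mvec \<Lambda> A (u k) x = mvec \<Lambda> B (u k) x"
  shows "A = B"
proof -
  have *: "(\<Sum>k\<in>\<Lambda>. mvec \<Lambda> C (u k) x * cnj (u k y)) = C x y" if "x \<in> \<Lambda>" "y \<in> \<Lambda>" for C x y
  proof -
    have "(\<Sum>k\<in>\<Lambda>. mvec \<Lambda> C (u k) x * cnj (u k y))
        = (\<Sum>k\<in>\<Lambda>. \<Sum>z\<in>\<Lambda>. C x z * (u k z * cnj (u k y)))"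
      by (simp add: mvec_def sum_distrib_right mult.assoc)
    also have "\<dots> = (\<Sum>z\<in>\<Lambda>. \<Sum>k\<in>\<Lambda>. C x z * (u k z * cnj (u k y)))"
      by (rule sum.swap)
    also have "\<dots> = (\<Sum>z\<in>\<Lambda>. if z = y then C x y else 0)"
      by (intro sum.cong refl) (auto simp: compl that simp flip: sum_distrib_left)
    also have "\<dots> = C x y" using fin that by simp
    finally show ?thesis .
  qed
  show ?thesis
  proof (intro ext)
    fix x y
    show "A x y = B x y"
    proof (cases "x \<in> \<Lambda> \<and> y \<in> \<Lambda>")
      case True
      then show ?thesis using *[of x y A] *[of x y B] eq by simp
    next
      case False
      then show ?thesis using A B by (auto simp: on_sites_def)
    qed
  qed
qed

end

section \<open>Spectral projections computed from an eigenbasis\<close>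

locale eigenbasis = onb +
  fixes A :: cmat and lam :: "site \<Rightarrow> real"
  assumes herm: "hermitian \<Lambda> A"
    and eig: "\<And>k. k \<in> \<Lambda> \<Longrightarrow> mvec \<Lambda> A (u k) = (\<lambda>x. of_real (lam k) * u k x)"
begin

lemma mtrace_mmul: "Re (mtrace \<Lambda> (mmul \<Lambda> A g)) = (\<Sum>k\<in>\<Lambda>. lam k * qf \<Lambda> g (u k))"
proof -
  have "mtrace \<Lambda> (mmul \<Lambda> A g) = (\<Sum>k\<in>\<Lambda>. of_real (lam k) * ip \<Lambda> (u k) (mvec \<Lambda> g (u k)))"
    by (subst mtrace_mmul_commute) (simp add: mtrace_onb mvec_mmul eig mvec_scale ip_scale_right)
  then show ?thesis by (simp add: qf_def)
qed

text \<open>The explicit candidate for \<open>spec_proj_below\<close>. The latter is a definite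
  description over the span of all eigenvectors, so existence and uniqueness come before any
  computation with it.\<close>

definition pbelow :: "real \<Rightarrow> cmat" where
  "pbelow c x y = (\<Sum>k\<in>{k\<in>\<Lambda>. lam k < c}. u k x * cnj (u k y))"

lemma mvec_pbelow: "mvec \<Lambda> (pbelow c) v = (\<lambda>x. \<Sum>k\<in>{k\<in>\<Lambda>. lam k < c}. u k x * ip \<Lambda> (u k) v)"
proof
  fix x
  show "mvec \<Lambda> (pbelow c) v x = (\<Sum>k\<in>{k\<in>\<Lambda>. lam k < c}. u k x * ip \<Lambda> (u k) v)"
    unfolding mvec_def pbelow_def ip_def sum_distrib_left sum_distrib_right
    by (subst sum.swap) (simp add: mult.assoc)
qed

lemma hermitian_pbelow: "hermitian \<Lambda> (pbelow c)"
proof (rule hermitianI)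
  show "pbelow c x y = 0" if "x \<notin> \<Lambda> \<or> y \<notin> \<Lambda>" for x y
    unfolding pbelow_def
    by (rule sum.neutral) (use that supp in \<open>auto simp: supported_def\<close>)
  show "pbelow c y x = cnj (pbelow c x y)" for x y
    by (simp add: pbelow_def mult.commute)
qed

lemma mvec_pbelow_u:
  assumes "l \<in> \<Lambda>"
  shows "mvec \<Lambda> (pbelow c) (u l) = (\<lambda>x. if lam l < c then u l x else 0)"
proof
  fix x
  have "mvec \<Lambda> (pbelow c) (u l) x = (\<Sum>k\<in>{k\<in>\<Lambda>. lam k < c}. if k = l then u l x else 0)"
    unfolding mvec_pbelow by (intro sum.cong) (auto simp: ortho assms)
  then show "mvec \<Lambda> (pbelow c) (u l) x = (if lam l < c then u l x else 0)"
    using fin assms by simp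
qed

lemma pbelow_idem_vec: "mvec \<Lambda> (pbelow c) (mvec \<Lambda> (pbelow c) v) = mvec \<Lambda> (pbelow c) v"
proof
  fix x
  define F where "F = {k\<in>\<Lambda>. lam k < c}"
  have "ip \<Lambda> (u k) (mvec \<Lambda> (pbelow c) v) = ip \<Lambda> (u k) v" if "k \<in> F" for k
  proof -
    have "ip \<Lambda> (u k) (mvec \<Lambda> (pbelow c) v) = (\<Sum>l\<in>F. ip \<Lambda> (u k) (u l) * ip \<Lambda> (u l) v)"
      unfolding mvec_pbelow F_def[symmetric]
      unfolding ip_def[of \<Lambda> "u k" "\<lambda>x. \<Sum>l\<in>F. u l x * ip \<Lambda> (u l) v"]
        ip_def[of \<Lambda> "u k" "u l" for l] sum_distrib_left sum_distrib_right
      by (subst sum.swap) (simp add: mult.assoc)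
    also have "\<dots> = (\<Sum>l\<in>F. if l = k then ip \<Lambda> (u k) v else 0)"
      using that by (intro sum.cong) (auto simp: ortho F_def)
    also have "\<dots> = ip \<Lambda> (u k) v" using that fin by (simp add: F_def)
    finally show ?thesis .
  qed
  then show "mvec \<Lambda> (pbelow c) (mvec \<Lambda> (pbelow c) v) x = mvec \<Lambda> (pbelow c) v x"
    by (simp add: mvec_pbelow[of c "mvec \<Lambda> (pbelow c) v"] F_def) (simp add: mvec_pbelow)
qed

lemma mmul_pbelow: "mmul \<Lambda> (pbelow c) (pbelow c) = pbelow c"
proof (rule mat_eqI)
  have "on_sites \<Lambda> (pbelow c)" using hermitian_pbelow by (simp add: hermitian_def)
  then show "on_sites \<Lambda> (pbelow c)" "on_sites \<Lambda> (mmul \<Lambda> (pbelow c) (pbelow c))"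
    by (auto simp: on_sites_def mmul_def)
qed (simp add: mvec_mmul pbelow_idem_vec)

text \<open>Eigenspaces of a Hermitian matrix are orthogonal. Here w is an arbitrary eigenvector
  rather than a basis vector, because \<open>span_below\<close> admits all of them.\<close>

lemma ip_eigvec_zero:
  assumes "eigvec \<Lambda> A l w" "k \<in> \<Lambda>" "lam k \<noteq> l"
  shows "ip \<Lambda> (u k) w = 0"
proof -
  have "of_real l * ip \<Lambda> (u k) w = ip \<Lambda> (u k) (mvec \<Lambda> A w)"
    using assms(1) by (simp add: eigvec_def ip_scale_right)
  also have "\<dots> = cnj (ip \<Lambda> w (mvec \<Lambda> A (u k)))" by (rule hermitian_ip[OF herm])
  also have "\<dots> = of_real (lam k) * ip \<Lambda> (u k) w"
    by (simp add: eig assms(2) ip_scale_right) (simp add: ip_commute[of _ "u k"])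
  finally show ?thesis using assms(3) by simp
qed

lemma eigvec_pbelow:
  assumes "eigvec \<Lambda> A l w" "l < c"
  shows "mvec \<Lambda> (pbelow c) w = w"
proof
  fix x
  have "mvec \<Lambda> (pbelow c) w x = (\<Sum>k\<in>\<Lambda>. u k x * ip \<Lambda> (u k) w)"
    unfolding mvec_pbelow
    by (rule sum.mono_neutral_left) (use fin ip_eigvec_zero[OF assms(1)] assms(2) in auto)
  also have "\<dots> = w x"
  proof (cases "x \<in> \<Lambda>")
    case False
    then have "u k x = 0" if "k \<in> \<Lambda>" for k using supp[OF that] by (simp add: supported_def)
    then show ?thesis using False assms(1) by (simp add: eigvec_def supported_def)
  qed (rule expand)
  finally show "mvec \<Lambda> (pbelow c) w x = w x" .
qed

lemma eigvec_u:
  assumes "k \<in> \<Lambda>" "a \<noteq> 0"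
  shows "eigvec \<Lambda> A (lam k) (\<lambda>x. u k x * a)"
proof -
  have "(\<lambda>x. u k x * a) \<noteq> (\<lambda>_. 0)"
  proof
    assume "(\<lambda>x. u k x * a) = (\<lambda>_. 0)"
    then have "u k x = 0" for x using assms(2) by (metis mult_eq_0_iff)
    then show False using ortho[of k k] assms(1) by (simp add: ip_def)
  qed
  moreover have "mvec \<Lambda> A (\<lambda>x. u k x * a) = (\<lambda>x. of_real (lam k) * (u k x * a))"
    using mvec_scale[of \<Lambda> A a "u k"] eig[OF assms(1)] by (simp add: mult_ac)
  ultimately show ?thesis
    using supp[OF assms(1)] by (auto simp: eigvec_def supported_def)
qed

lemma range_pbelow: "{mvec \<Lambda> (pbelow c) v | v. supported \<Lambda> v} = span_below \<Lambda> A c"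
proof (intro equalityI subsetI)
  fix f assume "f \<in> {mvec \<Lambda> (pbelow c) v | v. supported \<Lambda> v}"
  then obtain v where f: "f = mvec \<Lambda> (pbelow c) v" by auto
  \<comment> \<open>\<open>span_below\<close> uses sums without scalars, and \<open>eigvec\<close>
    excludes zero; so the coefficients are absorbed into the vectors and vanishing ones are
    dropped.\<close>
  define F where "F = {k\<in>\<Lambda>. lam k < c \<and> ip \<Lambda> (u k) v \<noteq> 0}"
  have "finite F" using fin by (simp add: F_def)
  then obtain ks where ks: "set ks = F" "distinct ks"
    using finite_distinct_list by metis
  define ps where "ps = map (\<lambda>k. (lam k, \<lambda>x. u k x * ip \<Lambda> (u k) v)) ks"
  have "\<forall>(l, w) \<in> set ps. l < c \<and> eigvec \<Lambda> A l w"
    unfolding ps_def using ks eigvec_u by (auto simp: F_def)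
  moreover have "f = (\<lambda>x. \<Sum>(l, w) \<leftarrow> ps. w x)"
  proof
    fix x
    have "f x = (\<Sum>k\<in>F. u k x * ip \<Lambda> (u k) v)"
      unfolding f mvec_pbelow
      by (rule sum.mono_neutral_right) (use fin in \<open>auto simp: F_def\<close>)
    also have "\<dots> = (\<Sum>k\<leftarrow>ks. u k x * ip \<Lambda> (u k) v)"
      using ks by (simp add: sum_list_distinct_conv_sum_set)
    also have "\<dots> = (\<Sum>(l, w) \<leftarrow> ps. w x)"
      by (simp add: ps_def o_def)
    finally show "f x = (\<Sum>(l, w) \<leftarrow> ps. w x)" .
  qed
  ultimately show "f \<in> span_below \<Lambda> A c"
    unfolding span_below_def by blast
next
  fix f assume "f \<in> span_below \<Lambda> A c"
  then obtain ps where ps: "\<forall>(l, w) \<in> set ps. l < c \<and> eigvec \<Lambda> A l w"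
    and f: "f = (\<lambda>x. \<Sum>(l, w) \<leftarrow> ps. w x)"
    unfolding span_below_def by blast
  have "supported \<Lambda> (\<lambda>x. \<Sum>(l, w) \<leftarrow> ps. w x) \<and>
      mvec \<Lambda> (pbelow c) (\<lambda>x. \<Sum>(l, w) \<leftarrow> ps. w x) = (\<lambda>x. \<Sum>(l, w) \<leftarrow> ps. w x)"
    using ps
  proof (induction ps)
    case Nil
    then show ?case by (simp add: supported_def mvec_def)
  next
    case (Cons p ps)
    obtain l w where p: "p = (l, w)" by (cases p)
    have w: "l < c" "eigvec \<Lambda> A l w" using Cons.prems p by auto
    show ?case
      using Cons.IH Cons.prems eigvec_pbelow[OF w(2,1)] w(2)
      by (simp add: p mvec_add) (simp add: supported_def eigvec_def)
  qed
  then show "f \<in> {mvec \<Lambda> (pbelow c) v | v. supported \<Lambda> v}" unfolding f by force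
qed

text \<open>If both have range S, then QP = P because Q fixes the range of P, and likewise PQ = Q;
  taking adjoints of the latter gives QP = Q. This makes the description in
  \<open>spec_proj_below\<close> well defined.\<close>

lemma orth_proj_unique:
  assumes P: "orth_proj_onto \<Lambda> P S" and Q: "orth_proj_onto \<Lambda> Q S"
  shows "P = Q"
proof -
  have QP: "mmul \<Lambda> Q P = P" if P: "orth_proj_onto \<Lambda> P S" and Q: "orth_proj_onto \<Lambda> Q S" for P Q
  proof (rule mat_eqI)
    have s: "on_sites \<Lambda> P" "on_sites \<Lambda> Q"
      using P Q unfolding orth_proj_onto_def hermitian_def by blast+
    show "on_sites \<Lambda> P" "on_sites \<Lambda> (mmul \<Lambda> Q P)"
      using s unfolding on_sites_def by (auto simp: mmul_def)
    fix k x assume "k \<in> \<Lambda>"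
    then have "mvec \<Lambda> P (u k) \<in> S" using P supp by (auto simp: orth_proj_onto_def)
    then obtain v where v: "mvec \<Lambda> P (u k) = mvec \<Lambda> Q v"
      using Q unfolding orth_proj_onto_def by blast
    have "mvec \<Lambda> Q (mvec \<Lambda> Q v) = mvec \<Lambda> Q v"
      using Q by (metis orth_proj_onto_def mvec_mmul)
    then show "mvec \<Lambda> (mmul \<Lambda> Q P) (u k) x = mvec \<Lambda> P (u k) x"
      by (simp add: mvec_mmul v)
  qed
  have hP: "hermitian \<Lambda> P" and hQ: "hermitian \<Lambda> Q"
    using P Q by (simp_all add: orth_proj_onto_def)
  have "mmul \<Lambda> Q P x y = Q x y" for x y
  proof -
    have "mmul \<Lambda> Q P x y = cnj (mmul \<Lambda> P Q y x)"
      by (simp add: mmul_def hermitian_cnj[OF hP] hermitian_cnj[OF hQ] mult.commute)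
    then show ?thesis using QP[OF Q P] by (simp add: hermitian_cnj[OF hQ])
  qed
  then show ?thesis using QP[OF P Q] by (auto simp: fun_eq_iff)
qed

lemma spec_proj_below_eq: "spec_proj_below \<Lambda> A c = pbelow c"
proof -
  have "orth_proj_onto \<Lambda> (pbelow c) (span_below \<Lambda> A c)"
    by (simp add: orth_proj_onto_def hermitian_pbelow mmul_pbelow range_pbelow)
  then show ?thesis
    unfolding spec_proj_below_def by (intro the_equality orth_proj_unique)
qed

lemma qf_pbelow_u:
  assumes "k \<in> \<Lambda>"
  shows "qf \<Lambda> (pbelow c) (u k) = of_bool (lam k < c)"
proof -
  have "ip \<Lambda> (u k) (\<lambda>x. 0) = 0" by (simp add: ip_def)
  then show ?thesis
    using assms ortho by (cases "lam k < c") (simp_all add: qf_def mvec_pbelow_u)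
qed

section \<open>Variational principle for one species\<close>

definition E0 :: real where "E0 = (\<Sum>k\<in>\<Lambda>. min (lam k) 0)"

lemma energy_pbelow: "Re (mtrace \<Lambda> (mmul \<Lambda> A (pbelow 0))) = E0"
  unfolding mtrace_mmul E0_def by (intro sum.cong) (auto simp: qf_pbelow_u)

lemma trace_neg_eq: "trace_neg \<Lambda> A = E0"
  by (simp add: trace_neg_def neg_part_def spec_proj_below_eq energy_pbelow)

lemma density_matrix_pbelow: "density_matrix \<Lambda> (pbelow c)"
  unfolding density_matrix_iff[OF fin]
proof (intro conjI allI)
  show "hermitian \<Lambda> (pbelow c)" by (rule hermitian_pbelow)
  fix v
  have "ip \<Lambda> v (mvec \<Lambda> (pbelow c) v)
      = (\<Sum>k\<in>{k\<in>\<Lambda>. lam k < c}. ip \<Lambda> v (u k) * ip \<Lambda> (u k) v)"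
    unfolding mvec_pbelow ip_def[of _ v] sum_distrib_left sum_distrib_right
    by (subst sum.swap) (simp add: mult.assoc)
  also have "\<dots> = of_real (\<Sum>k\<in>{k\<in>\<Lambda>. lam k < c}. (cmod (ip \<Lambda> (u k) v))\<^sup>2)"
    unfolding of_real_sum
    by (intro sum.cong refl) (metis complex_norm_square ip_commute mult.commute of_real_power)
  finally have q: "qf \<Lambda> (pbelow c) v = (\<Sum>k\<in>{k\<in>\<Lambda>. lam k < c}. (cmod (ip \<Lambda> (u k) v))\<^sup>2)"
    by (simp add: qf_def)
  show "0 \<le> qf \<Lambda> (pbelow c) v" unfolding q by (simp add: sum_nonneg)
  have "qf \<Lambda> (pbelow c) v \<le> (\<Sum>k\<in>\<Lambda>. (cmod (ip \<Lambda> (u k) v))\<^sup>2)"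
    unfolding q by (rule sum_mono2) (use fin in auto)
  then show "qf \<Lambda> (pbelow c) v \<le> (\<Sum>x\<in>\<Lambda>. (cmod (v x))\<^sup>2)" by (simp add: parseval)
qed

lemma norm_u: "k \<in> \<Lambda> \<Longrightarrow> (\<Sum>x\<in>\<Lambda>. (cmod (u k x))\<^sup>2) = 1"
  using ortho[of k k] ip_self[of \<Lambda> "u k"] by (metis of_bool_eq(2) of_real_eq_1_iff)

lemma qf_u_bounds:
  assumes "density_matrix \<Lambda> g" "k \<in> \<Lambda>"
  shows "0 \<le> qf \<Lambda> g (u k)" "qf \<Lambda> g (u k) \<le> 1"
  using assms norm_u[of k] unfolding density_matrix_iff[OF fin] by metis+

lemma energy_ge:
  assumes g: "density_matrix \<Lambda> g"
  shows "E0 \<le> Re (mtrace \<Lambda> (mmul \<Lambda> A g))"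
  unfolding mtrace_mmul E0_def
proof (rule sum_mono)
  fix k assume k: "k \<in> \<Lambda>"
  show "min (lam k) 0 \<le> lam k * qf \<Lambda> g (u k)"
    using qf_u_bounds[OF g k] mult_left_mono_neg[of "qf \<Lambda> g (u k)" 1 "lam k"]
    by (cases "lam k \<le> 0") (auto simp: min_def)
qed

text \<open>Equality in the level-by-level comparison forces occupation 1 on negative levels and 0
  on positive ones; the absence of zero levels removes the remaining freedom.\<close>

lemma energy_unique:
  assumes g: "density_matrix \<Lambda> g" and nz: "\<And>k. k \<in> \<Lambda> \<Longrightarrow> lam k \<noteq> 0"
    and eq: "Re (mtrace \<Lambda> (mmul \<Lambda> A g)) = E0"
  shows "g = pbelow 0"
proof (rule mat_eqI)
  show "on_sites \<Lambda> g" using g by (simp add: density_matrix_def psd_def hermitian_def)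
  show "on_sites \<Lambda> (pbelow 0)" using hermitian_pbelow by (simp add: hermitian_def)
  have le: "min (lam k) 0 \<le> lam k * qf \<Lambda> g (u k)" if k: "k \<in> \<Lambda>" for k
    using qf_u_bounds[OF g k] mult_left_mono_neg[of "qf \<Lambda> g (u k)" 1 "lam k"]
    by (cases "lam k \<le> 0") (auto simp: min_def)
  have "(\<Sum>k\<in>\<Lambda>. min (lam k) 0) = (\<Sum>k\<in>\<Lambda>. lam k * qf \<Lambda> g (u k))"
    using eq by (simp add: mtrace_mmul E0_def)
  then have eqk: "min (lam k) 0 = lam k * qf \<Lambda> g (u k)" if "k \<in> \<Lambda>" for k
    by (rule sum_mono_inv[OF _ le that fin])
  \<comment> \<open>An occupation is a single diagonal entry; positivity turns its vanishing into
    the vanishing of \<open>h u\<close>. This is used for g on empty levels and for the hole matrix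
    on filled ones.\<close>
  have vanish: "mvec \<Lambda> h (u k) x = 0" if "density_matrix \<Lambda> h" "qf \<Lambda> h (u k) = 0" "x \<in> \<Lambda>" for h k x
  proof -
    have "(\<Sum>x\<in>\<Lambda>. (cmod (mvec \<Lambda> h (u k) x))\<^sup>2) \<le> 0"
      using density_matrix_norm_sq[OF fin that(1), of "u k"] that(2) by simp
    then have "(\<Sum>x\<in>\<Lambda>. (cmod (mvec \<Lambda> h (u k) x))\<^sup>2) = 0"
      by (intro antisym sum_nonneg) auto
    then show ?thesis using fin that(3) by (simp add: sum_nonneg_eq_0_iff)
  qed
  fix k x assume k: "k \<in> \<Lambda>" and x: "x \<in> \<Lambda>"
  show "mvec \<Lambda> g (u k) x = mvec \<Lambda> (pbelow 0) (u k) x"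
  proof (cases "lam k < 0")
    case True
    have "density_matrix \<Lambda> (\<lambda>x y. idm \<Lambda> x y - g x y)"
      using g unfolding density_matrix_def by simp
    moreover have "qf \<Lambda> (\<lambda>x y. idm \<Lambda> x y - g x y) (u k) = 0"
      using eqk[OF k] True norm_u[OF k] by (simp add: qf_diff qf_idm[OF fin])
    ultimately have "mvec \<Lambda> (\<lambda>x y. idm \<Lambda> x y - g x y) (u k) x = 0" using vanish x by blast
    then show ?thesis using True k x by (simp add: mvec_pbelow_u mvec_diff_mat mvec_idm[OF fin])
  next
    case False
    then have "qf \<Lambda> g (u k) = 0" using eqk[OF k] nz[OF k] by simp
    then show ?thesis using vanish[OF g _ x] False k by (simp add: mvec_pbelow_u)
  qed
qed

text \<open>With \<open>\<chi>\<close> the cutoff to \<open>B\<close>, a small excess energy means that \<open>\<gamma> = \<chi>g\<chi>\<close> has small mass above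
  the Fermi level and \<open>\<chi> - \<gamma>\<close> has small mass below it; their sum \<open>\<chi>\<close> then has small blocks
  between the two.\<close>

lemma energy_restr_ge:
  assumes g: "density_matrix \<Lambda> g" and B: "B \<subseteq> \<Lambda>" and d: "0 < \<delta>"
    and flat: "\<And>k x. k \<in> \<Lambda> \<Longrightarrow> x \<in> \<Lambda> \<Longrightarrow> (cmod (u k x))\<^sup>2 = 1 / card \<Lambda>"
  shows "card B / card \<Lambda> * E0
      + \<delta> / 2 * (\<Sum>k\<in>{k\<in>\<Lambda>. lam k \<le> -\<delta>}. \<Sum>l\<in>{l\<in>\<Lambda>. \<delta> \<le> lam l}.
          (cmod (ip \<Lambda> (u k) (\<lambda>x. of_bool (x \<in> B) * u l x)))\<^sup>2)
    \<le> Re (mtrace \<Lambda> (mmul \<Lambda> A (restr B g)))"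
proof -
  define G where "G = restr B g"
  define D where "D = (\<lambda>x y. restr B (idm \<Lambda>) x y - restr B g x y)"
  have G: "density_matrix \<Lambda> G" and D: "density_matrix \<Lambda> D"
    unfolding G_def D_def using restr_density_matrix[OF fin g B] by auto
  have GD: "mvec \<Lambda> G v x + mvec \<Lambda> D v x = of_bool (x \<in> B) * v x" for v x
  proof -
    have "mvec \<Lambda> (restr B (idm \<Lambda>)) v x = (\<Sum>y\<in>\<Lambda>. if y = x then of_bool (x \<in> B) * v x else 0)"
      unfolding mvec_def by (intro sum.cong) (auto simp: restr_def idm_def)
    then show ?thesis
      using fin B by (auto simp: D_def G_def mvec_diff_mat)
  qed
  have ipGD: "ip \<Lambda> w (mvec \<Lambda> G v) + ip \<Lambda> w (mvec \<Lambda> D v) = ip \<Lambda> w (\<lambda>x. of_bool (x \<in> B) * v x)" for v w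
    unfolding ip_add_right[symmetric] GD ..
  \<comment> \<open>Flatness enters here: after the cutoff every level carries the same weight
    |B|/|\<Lambda>|, divided between particles (G) and holes (D).\<close>
  have diag: "qf \<Lambda> G (u k) + qf \<Lambda> D (u k) = card B / card \<Lambda>" if k: "k \<in> \<Lambda>" for k
  proof -
    have "ip \<Lambda> (u k) (\<lambda>x. of_bool (x \<in> B) * u k x)
        = of_real (\<Sum>x\<in>\<Lambda>. if x \<in> B then (cmod (u k x))\<^sup>2 else 0)"
      unfolding ip_def of_real_sum
    proof (intro sum.cong refl)
      fix x
      show "cnj (u k x) * (of_bool (x \<in> B) * u k x) =
          complex_of_real (if x \<in> B then (cmod (u k x))\<^sup>2 else 0)"
        using complex_norm_square[of "u k x"] by (simp add: mult.commute)
    qed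
    then have "qf \<Lambda> G (u k) + qf \<Lambda> D (u k) = (\<Sum>x\<in>\<Lambda>. if x \<in> B then (cmod (u k x))\<^sup>2 else 0)"
      using arg_cong[OF ipGD[of "u k" "u k"], of Re] by (simp add: qf_def)
    also have "\<dots> = (\<Sum>x\<in>\<Lambda>. if x \<in> B then 1 / card \<Lambda> else 0)"
      using k by (intro sum.cong) (auto simp: flat)
    also have "\<dots> = card B / card \<Lambda>"
      using B fin by (simp add: sum.If_cases Int_absorb1)
    finally show ?thesis .
  qed
  define F where "F = {k\<in>\<Lambda>. lam k \<le> -\<delta>}"
  define U where "U = {l\<in>\<Lambda>. \<delta> \<le> lam l}"
  have FU: "F \<subseteq> \<Lambda>" "U \<subseteq> \<Lambda>" "finite F" "finite U" using fin by (auto simp: F_def U_def)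
  \<comment> \<open>All matrix elements leaving level k are paid for together by the one expectation
    at k, however many partners l there are.\<close>
  have mass: "(\<Sum>l\<in>\<Lambda>. (cmod (ip \<Lambda> (u l) (mvec \<Lambda> h (u k))))\<^sup>2) \<le> qf \<Lambda> h (u k)"
    if "density_matrix \<Lambda> h" for h k
    using density_matrix_norm_sq[OF fin that, of "u k"] by (simp add: parseval)
  have sq: "(cmod (a + b))\<^sup>2 \<le> 2 * (cmod a)\<^sup>2 + 2 * (cmod b)\<^sup>2" for a b
  proof -
    have "(cmod (a + b))\<^sup>2 \<le> (cmod a + cmod b)\<^sup>2" by (intro power_mono norm_triangle_ineq) simp
    also have "\<dots> \<le> 2 * (cmod a)\<^sup>2 + 2 * (cmod b)\<^sup>2"
      using sum_squares_bound[of "cmod a" "cmod b"] by (simp add: power2_sum)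
    finally show ?thesis .
  qed
  have "(\<Sum>k\<in>F. \<Sum>l\<in>U. (cmod (ip \<Lambda> (u k) (\<lambda>x. of_bool (x \<in> B) * u l x)))\<^sup>2)
      \<le> (\<Sum>k\<in>F. \<Sum>l\<in>U. 2 * (cmod (ip \<Lambda> (u k) (mvec \<Lambda> G (u l))))\<^sup>2
          + 2 * (cmod (ip \<Lambda> (u k) (mvec \<Lambda> D (u l))))\<^sup>2)"
    unfolding ipGD[symmetric] by (intro sum_mono sq)
  \<comment> \<open>G is charged to the levels in U, which should be empty, and D to those in F,
    which should be full; for D the matrix element is transposed by Hermiticity.\<close>
  also have "\<dots> = 2 * (\<Sum>l\<in>U. \<Sum>k\<in>F. (cmod (ip \<Lambda> (u k) (mvec \<Lambda> G (u l))))\<^sup>2)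
      + 2 * (\<Sum>k\<in>F. \<Sum>l\<in>U. (cmod (ip \<Lambda> (u l) (mvec \<Lambda> D (u k))))\<^sup>2)"
  proof -
    have "cmod (ip \<Lambda> (u k) (mvec \<Lambda> D (u l))) = cmod (ip \<Lambda> (u l) (mvec \<Lambda> D (u k)))" for k l
      using D hermitian_ip[of \<Lambda> D "u k" "u l"] by (simp add: density_matrix_iff[OF fin])
    then show ?thesis
      by (simp add: sum.distrib sum_distrib_left sum.swap[of _ U F])
  qed
  also have "\<dots> \<le> 2 * (\<Sum>l\<in>U. qf \<Lambda> G (u l)) + 2 * (\<Sum>k\<in>F. qf \<Lambda> D (u k))"
    by (intro add_mono mult_left_mono sum_mono order.trans[OF _ mass[OF G]]
        order.trans[OF _ mass[OF D]] sum_mono2) (use FU fin in auto)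
  finally have main: "(\<Sum>k\<in>F. \<Sum>l\<in>U. (cmod (ip \<Lambda> (u k) (\<lambda>x. of_bool (x \<in> B) * u l x)))\<^sup>2)
      \<le> 2 * (\<Sum>l\<in>U. qf \<Lambda> G (u l)) + 2 * (\<Sum>k\<in>F. qf \<Lambda> D (u k))" .
  have "card B / card \<Lambda> * E0 + \<delta> * ((\<Sum>l\<in>U. qf \<Lambda> G (u l)) + (\<Sum>k\<in>F. qf \<Lambda> D (u k)))
      = (\<Sum>k\<in>\<Lambda>. card B / card \<Lambda> * min (lam k) 0
          + \<delta> * ((if k \<in> U then qf \<Lambda> G (u k) else 0) + (if k \<in> F then qf \<Lambda> D (u k) else 0)))"
    unfolding E0_def sum.distrib sum_distrib_left[symmetric]
    using FU fin by (simp add: sum.If_cases Int_absorb1)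
  also have "\<dots> \<le> (\<Sum>k\<in>\<Lambda>. lam k * qf \<Lambda> G (u k))"
  proof (rule sum_mono)
    fix k assume k: "k \<in> \<Lambda>"
    define b where "b = card B / card \<Lambda>"
    have b: "b = qf \<Lambda> G (u k) + qf \<Lambda> D (u k)" using diag[OF k] by (simp add: b_def)
    note pos = qf_u_bounds(1)[OF G k] qf_u_bounds(1)[OF D k]
    show "card B / card \<Lambda> * min (lam k) 0
          + \<delta> * ((if k \<in> U then qf \<Lambda> G (u k) else 0) + (if k \<in> F then qf \<Lambda> D (u k) else 0))
        \<le> lam k * qf \<Lambda> G (u k)"
    \<comment> \<open>On a negative level \<open>lam k * qf \<Lambda> G (u k)\<close> equals
      \<open>lam k * b - lam k * qf \<Lambda> D (u k)\<close>, so holes cost \<open>- lam k\<close>,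
      at least \<delta> on F. On a nonnegative level particles cost \<open>lam k\<close>, at least
      \<delta> on U.\<close>
    proof (cases "lam k < 0")
      case True
      then have "k \<notin> U" using d by (auto simp: U_def)
      moreover have "\<delta> * qf \<Lambda> D (u k) \<le> - lam k * qf \<Lambda> D (u k)" if "k \<in> F"
        using that pos by (intro mult_right_mono) (auto simp: F_def)
      moreover have "0 \<le> - lam k * qf \<Lambda> D (u k)" using True pos by (intro mult_nonneg_nonneg) auto
      ultimately show ?thesis
        using True unfolding b_def[symmetric] b by (auto simp: algebra_simps)
    next
      case False
      then have "k \<notin> F" using d by (auto simp: F_def)
      moreover have "\<delta> * qf \<Lambda> G (u k) \<le> lam k * qf \<Lambda> G (u k)" if "k \<in> U"
        using that pos by (intro mult_right_mono) (auto simp: U_def)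
      moreover have "0 \<le> lam k * qf \<Lambda> G (u k)" using False pos by simp
      ultimately show ?thesis using False by auto
    qed
  qed
  also have "\<dots> = Re (mtrace \<Lambda> (mmul \<Lambda> A (restr B g)))"
    by (simp add: mtrace_mmul G_def)
  finally have "card B / card \<Lambda> * E0 + \<delta> * ((\<Sum>l\<in>U. qf \<Lambda> G (u l)) + (\<Sum>k\<in>F. qf \<Lambda> D (u k)))
      \<le> Re (mtrace \<Lambda> (mmul \<Lambda> A (restr B g)))" .
  moreover have "\<delta> / 2 * (\<Sum>k\<in>F. \<Sum>l\<in>U. (cmod (ip \<Lambda> (u k) (\<lambda>x. of_bool (x \<in> B) * u l x)))\<^sup>2)
      \<le> \<delta> / 2 * (2 * (\<Sum>l\<in>U. qf \<Lambda> G (u l)) + 2 * (\<Sum>k\<in>F. qf \<Lambda> D (u k)))"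
    using d main by (intro mult_left_mono) auto
  ultimately show ?thesis by (simp add: F_def U_def algebra_simps)
qed

end

section \<open>Plane waves on the discrete torus\<close>

definition tadd :: "nat \<Rightarrow> site \<Rightarrow> site \<Rightarrow> site" where
  "tadd L x y = (\<lambda>i. (x i + y i) mod L)"

definition unit_site :: "nat \<Rightarrow> nat \<Rightarrow> site" where
  "unit_site i c = (\<lambda>j. if j = i then c else 0)"

lemma lattice_Suc: "lattice (Suc d) L = (\<lambda>(x, j). x(d := j)) ` (lattice d L \<times> {..<L})"
proof (intro equalityI subsetI)
  fix x assume x: "x \<in> lattice (Suc d) L"
  then have "x(d := 0) \<in> lattice d L" "x d < L" by (auto simp: lattice_def)
  then show "x \<in> (\<lambda>(x, j). x(d := j)) ` (lattice d L \<times> {..<L})"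
    by (intro image_eqI[of _ _ "(x(d := 0), x d)"] SigmaI) simp_all
qed (auto simp: lattice_def less_Suc_eq)

lemma finite_lattice [simp]: "finite (lattice d L)"
proof (induction d)
  case 0
  have "lattice 0 L = {\<lambda>_. 0}" by (auto simp: lattice_def)
  then show ?case by simp
qed (simp add: lattice_Suc)

lemma card_lattice: "card (lattice d L) = L ^ d"
proof (induction d)
  case 0
  have "lattice 0 L = {\<lambda>_. 0}" by (auto simp: lattice_def)
  then show ?case by simp
next
  case (Suc d)
  have "inj_on (\<lambda>(x, j). x(d := j)) (lattice d L \<times> {..<L})"
  proof (rule inj_onI, clarify)
    fix x y :: site and i j :: nat
    assume x: "x \<in> lattice d L" and y: "y \<in> lattice d L" and eq: "x(d := i) = y(d := j)"
    have "x k = y k" for k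
      using fun_cong[OF eq, of k] x y by (cases "k = d") (auto simp: lattice_def)
    then show "x = y \<and> i = j" using fun_cong[OF eq, of d] by auto
  qed
  then show ?case
    by (simp add: lattice_Suc card_image card_cartesian_product Suc)
qed

lemma tadd_in_lattice: "x \<in> lattice d L \<Longrightarrow> a \<in> lattice d L \<Longrightarrow> tadd L x a \<in> lattice d L"
  unfolding lattice_def tadd_def by (auto intro!: mod_less_divisor intro: le_less_trans)

lemma unit_in_lattice: "i < d \<Longrightarrow> c < L \<Longrightarrow> unit_site i c \<in> lattice d L"
  by (auto simp: lattice_def unit_site_def)

lemma tadd_unit:
  assumes "x \<in> lattice d L" "i < d"
  shows "tadd L x (unit_site i c) = x(i := (x i + c) mod L)"
proof
  fix j
  show "tadd L x (unit_site i c) j = (x(i := (x i + c) mod L)) j"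
    using assms by (cases "j < d") (auto simp: tadd_def unit_site_def lattice_def)
qed

lemma tadd_unit_unit:
  "x \<in> lattice d L \<Longrightarrow> tadd L (tadd L x (unit_site i a)) (unit_site i b) = tadd L x (unit_site i (a + b))"
  by (rule ext) (auto simp: tadd_def unit_site_def mod_simps add.assoc)

lemma tadd_unit_L:
  assumes "x \<in> lattice d L" shows "tadd L x (unit_site i L) = x"
proof
  fix j
  show "tadd L x (unit_site i L) j = x j"
    using assms by (cases "j < d") (auto simp: tadd_def unit_site_def lattice_def)
qed

lemma bij_tadd:
  assumes a: "a \<in> lattice d L"
  shows "bij_betw (\<lambda>x. tadd L x a) (lattice d L) (lattice d L)"
proof -
  have "inj_on (\<lambda>x. tadd L x a) (lattice d L)"
  proof (rule inj_onI)
    fix x y assume x: "x \<in> lattice d L" and y: "y \<in> lattice d L" and eq: "tadd L x a = tadd L y a"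
    show "x = y"
    proof
      fix i
      show "x i = y i"
      proof (cases "i < d")
        case True
        have lt: "x i < L" "y i < L" "a i < L" using x y a True by (auto simp: lattice_def)
        have "(x i + a i) mod L = (y i + a i) mod L"
          using fun_cong[OF eq, of i] by (simp add: tadd_def)
        then show ?thesis using lt
          by (auto simp: mod_if split: if_splits)
      qed (use x y in \<open>auto simp: lattice_def\<close>)
    qed
  qed
  moreover have "(\<lambda>x. tadd L x a) ` lattice d L \<subseteq> lattice d L"
    using tadd_in_lattice a by auto
  ultimately show ?thesis
    using endo_inj_surj[OF finite_lattice] by (simp add: bij_betw_def)
qed

lemma sum_tadd:
  "a \<in> lattice d L \<Longrightarrow> (\<Sum>x\<in>lattice d L. f (tadd L x a)) = (\<Sum>x\<in>lattice d L. f x)"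
  using sum.reindex_bij_betw[OF bij_tadd] by blast

definition zeta :: "nat \<Rightarrow> complex" where "zeta L = cis (2 * pi / real L)"

lemma zeta_power: "zeta L ^ m = cis (2 * pi * real m / real L)"
  unfolding zeta_def DeMoivre by (simp add: mult_ac)

lemma zeta_power_L: "L > 0 \<Longrightarrow> zeta L ^ L = 1"
  by (simp add: zeta_power)

lemma zeta_mod: "L > 0 \<Longrightarrow> zeta L ^ (m mod L) = zeta L ^ m"
proof -
  assume "L > 0"
  have "zeta L ^ m = zeta L ^ (L * (m div L) + m mod L)" by simp
  also have "\<dots> = zeta L ^ (m mod L)"
    unfolding power_add power_mult zeta_power_L[OF \<open>L > 0\<close>] by simp
  finally show ?thesis by simp
qed

lemma cmod_zeta_power [simp]: "cmod (zeta L ^ m) = 1"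
  by (simp add: zeta_power)

lemma zeta_power_inj:
  assumes "a < L" "b < L" "zeta L ^ a = zeta L ^ b"
  shows "a = b"
  using bij_betw_roots_unity[of L] assms
  unfolding zeta_power bij_betw_def inj_on_def by auto

text \<open>The character exp(2 pi i k.x / L). The exponent stays unreduced, which is harmless for
  an L-th root of unity, and the formula is symmetric in momentum and position.\<close>

definition phase :: "nat \<Rightarrow> nat \<Rightarrow> site \<Rightarrow> site \<Rightarrow> complex" where
  "phase d L k x = zeta L ^ (\<Sum>i<d. k i * x i)"

lemma phase_commute: "phase d L k x = phase d L x k"
  by (simp add: phase_def mult.commute)

lemma cmod_phase [simp]: "cmod (phase d L k x) = 1"
  unfolding phase_def by (rule cmod_zeta_power)

lemma phase_tadd:
  assumes "L > 0"
  shows "phase d L k (tadd L x y) = phase d L k x * phase d L k y"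
proof -
  have "(\<Sum>i<d. k i * tadd L x y i) mod L = (\<Sum>i<d. k i * x i + k i * y i) mod L"
    unfolding mod_sum_eq[of "\<lambda>i. k i * tadd L x y i", symmetric]
      mod_sum_eq[of "\<lambda>i. k i * x i + k i * y i", symmetric]
    by (simp add: tadd_def mod_simps distrib_left)
  then have "phase d L k (tadd L x y) = zeta L ^ (\<Sum>i<d. k i * x i + k i * y i)"
    unfolding phase_def using zeta_mod[OF assms] by metis
  then show ?thesis by (simp add: phase_def sum.distrib power_add)
qed

lemma phase_unit: "i < d \<Longrightarrow> phase d L k (unit_site i c) = zeta L ^ (k i * c)"
  by (simp add: phase_def unit_site_def if_distrib cong: if_cong)

text \<open>Translating by one step in a direction where k and l differ permutes the summands and
  multiplies the sum by a factor c other than 1, so the sum vanishes.\<close>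

lemma phase_orthogonal:
  assumes L: "L \<ge> 2" and k: "k \<in> lattice d L" and l: "l \<in> lattice d L"
  shows "(\<Sum>x\<in>lattice d L. cnj (phase d L k x) * phase d L l x) = of_bool (k = l) * of_nat (L ^ d)"
proof (cases "k = l")
  case True
  have "cnj (phase d L l x) * phase d L l x = 1" for x
    using complex_norm_square[of "phase d L l x"] by (simp add: mult.commute)
  then show ?thesis by (simp add: True card_lattice)
next
  case False
  then obtain i where i: "k i \<noteq> l i" by auto
  then have "i < d" using k l unfolding lattice_def by (cases "i < d") auto
  define e where "e = unit_site i 1"
  have e: "e \<in> lattice d L" using unit_in_lattice[OF \<open>i < d\<close>] L by (simp add: e_def)
  define f where "f x = cnj (phase d L k x) * phase d L l x" for x
  define c where "c = cnj (zeta L ^ k i) * zeta L ^ l i"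
  have "f (tadd L x e) = c * f x" for x
    using L \<open>i < d\<close> by (simp add: f_def phase_tadd e_def phase_unit c_def)
  then have "(\<Sum>x\<in>lattice d L. f x) = c * (\<Sum>x\<in>lattice d L. f x)"
    using sum_tadd[OF e, of f] by (simp add: sum_distrib_left)
  moreover have "c \<noteq> 1"
  proof
    assume "c = 1"
    then have "zeta L ^ k i * c = zeta L ^ k i" by simp
    moreover have "zeta L ^ k i * c = zeta L ^ l i"
      using complex_norm_square[of "zeta L ^ k i"] unfolding c_def mult.assoc[symmetric] by simp
    ultimately have "zeta L ^ k i = zeta L ^ l i" by simp
    then show False using zeta_power_inj i k l \<open>i < d\<close> by (auto simp: lattice_def)
  qed
  ultimately have "(\<Sum>x\<in>lattice d L. f x) = 0"
    by (metis mult_cancel_right1)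
  then show ?thesis by (simp add: False f_def)
qed

definition pw :: "nat \<Rightarrow> nat \<Rightarrow> site \<Rightarrow> cvec" where
  "pw d L k x = (if x \<in> lattice d L then phase d L k x / of_real (sqrt (real (L ^ d))) else 0)"

lemma pw_norm:
  assumes "L > 0" "x \<in> lattice d L"
  shows "(cmod (pw d L k x))\<^sup>2 = 1 / card (lattice d L)"
  using assms by (simp add: pw_def norm_divide power_divide card_lattice)

text \<open>Orthonormality and completeness are the same character sum, taken once over positions
  and once over momenta.\<close>

lemma onb_pw:
  assumes L: "L \<ge> 2"
  shows "onb (lattice d L) (pw d L)"
proof
  have s: "complex_of_real (sqrt (real (L ^ d))) * complex_of_real (sqrt (real (L ^ d))) = of_nat (L ^ d)"
    by (simp flip: of_real_mult del: of_nat_power)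
  have nz: "(of_nat (L ^ d) :: complex) \<noteq> 0" using L by simp
  show "finite (lattice d L)" by simp
  show "supported (lattice d L) (pw d L k)" for k
    by (simp add: supported_def pw_def)
  have aux: "cnj (a / of_real (sqrt (real (L ^ d)))) * (b / of_real (sqrt (real (L ^ d))))
      = cnj a * b / of_nat (L ^ d)" for a b
    by (simp add: s del: of_nat_power)
  fix k l assume k: "k \<in> lattice d L" and l: "l \<in> lattice d L"
  have "ip (lattice d L) (pw d L k) (pw d L l) =
      (\<Sum>x\<in>lattice d L. cnj (phase d L k x) * phase d L l x) / of_nat (L ^ d)"
    unfolding ip_def sum_divide_distrib
    by (intro sum.cong refl) (simp only: pw_def if_True aux)
  then show "ip (lattice d L) (pw d L k) (pw d L l) = of_bool (k = l)"
    unfolding phase_orthogonal[OF L k l] using L by auto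
  have "(\<Sum>x\<in>lattice d L. pw d L x k * cnj (pw d L x l))
      = (\<Sum>x\<in>lattice d L. cnj (phase d L l x) * phase d L k x) / of_nat (L ^ d)"
    unfolding sum_divide_distrib
    by (intro sum.cong refl)
      (simp only: pw_def if_True aux k l mult.commute[of _ "cnj _"] phase_commute[of d L _ k] phase_commute[of d L _ l])
  then show "(\<Sum>x\<in>lattice d L. pw d L x k * cnj (pw d L x l)) = of_bool (k = l)"
    unfolding phase_orthogonal[OF L l k] using L by auto
qed

section \<open>The hopping matrix in coordinates and its diagonalisation\<close>

lemma cdist_nonneg: "L > 0 \<Longrightarrow> 0 \<le> cdist L a b"
  by (simp add: cdist_def)

lemma cdist_cases:
  assumes "a < L" "b < L" "L \<ge> 3"
  shows "cdist L a b = 0 \<longleftrightarrow> a = b"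
    and "cdist L a b = 1 \<longleftrightarrow> b = (a + 1) mod L \<or> b = (a + (L - 1)) mod L"
proof -
  have m: "(int a - int b) mod int L = (if b \<le> a then int a - int b else int a - int b + int L)"
    if "a < L" "b < L" for a b
  proof (cases "b \<le> a")
    case True
    then show ?thesis using that by (intro mod_pos_pos_trivial[THEN trans]) auto
  next
    case False
    have "(int a - int b) mod int L = (int a - int b + int L) mod int L" by simp
    also have "\<dots> = int a - int b + int L"
      using that False by (intro mod_pos_pos_trivial) auto
    finally show ?thesis using False by simp
  qed
  have p: "(a + 1) mod L = (if a + 1 = L then 0 else a + 1)" using assms by auto
  have q: "(a + (L - 1)) mod L = (if a = 0 then L - 1 else a - 1)"
    using assms by (auto simp: mod_if)
  show "cdist L a b = 0 \<longleftrightarrow> a = b"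
    using assms unfolding cdist_def m[OF assms(1,2)] m[OF assms(2,1)] by auto
  show "cdist L a b = 1 \<longleftrightarrow> b = (a + 1) mod L \<or> b = (a + (L - 1)) mod L"
    using assms unfolding cdist_def m[OF assms(1,2)] m[OF assms(2,1)] p q
    by (auto simp: min_def split: if_splits)
qed

lemma sum_int_eq_1_iff:
  fixes f :: "'a \<Rightarrow> int"
  assumes fin: "finite S" and pos: "\<And>i. i \<in> S \<Longrightarrow> 0 \<le> f i"
  shows "sum f S = 1 \<longleftrightarrow> (\<exists>i\<in>S. f i = 1 \<and> (\<forall>j\<in>S. j \<noteq> i \<longrightarrow> f j = 0))"
proof -
  have "sum f S = int (sum (\<lambda>i. nat (f i)) S)"
    using pos by simp
  then have "sum f S = 1 \<longleftrightarrow> sum (\<lambda>i. nat (f i)) S = 1" by linarith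
  also have "\<dots> \<longleftrightarrow> (\<exists>i\<in>S. nat (f i) = 1 \<and> (\<forall>j\<in>S. i \<noteq> j \<longrightarrow> nat (f j) = 0))"
    using sum_eq_1_iff[OF fin, of "\<lambda>i. nat (f i)"] by simp
  also have "\<dots> \<longleftrightarrow> (\<exists>i\<in>S. f i = 1 \<and> (\<forall>j\<in>S. j \<noteq> i \<longrightarrow> f j = 0))"
    using pos by (intro bex_cong refl conj_cong) (auto simp: nat_eq_iff order.antisym)
  finally show ?thesis .
qed

text \<open>Distance one means that one coordinate moves by one step and no other moves. A backward
  step is written as a forward step by \<open>L - 1\<close>; L >= 3 keeps the two neighbours in a
  direction distinct, so that no site is counted twice.\<close>

lemma hopping_eq:
  assumes L: "L \<ge> 3" and x: "x \<in> lattice d L" and y: "y \<in> lattice d L"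
  shows "hopping d L x y = (\<Sum>i<d. of_bool (y = tadd L x (unit_site i 1))
      + of_bool (y = tadd L x (unit_site i (L - 1))))"
proof -
  define p where "p i = (x i + 1) mod L" for i
  define m where "m i = (x i + (L - 1)) mod L" for i
  have lt: "x i < L" "y i < L" if "i < d" for i using x y that by (auto simp: lattice_def)
  have pm: "p i \<noteq> x i" "m i \<noteq> x i" "p i \<noteq> m i" if "i < d" for i
    using lt[OF that] L by (auto simp: p_def m_def mod_if)
  have yx: "y = x(i := c) \<longleftrightarrow> y i = c \<and> (\<forall>j<d. j \<noteq> i \<longrightarrow> x j = y j)" if "i < d" for i c
    using x y that by (auto simp: fun_eq_iff lattice_def) (metis not_less)
  have "dist1 d L x y = 1 \<longleftrightarrow>
      (\<exists>i<d. cdist L (x i) (y i) = 1 \<and> (\<forall>j<d. j \<noteq> i \<longrightarrow> cdist L (x j) (y j) = 0))"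
    unfolding dist1_def using L by (subst sum_int_eq_1_iff) (auto intro: cdist_nonneg)
  also have "\<dots> \<longleftrightarrow> (\<exists>i<d. y = x(i := p i) \<or> y = x(i := m i))"
    using yx lt L by (auto simp: cdist_cases p_def m_def)
  finally have D: "dist1 d L x y = 1 \<longleftrightarrow> (\<exists>i<d. y = x(i := p i) \<or> y = x(i := m i))" .
  have R: "(\<Sum>i<d. of_bool (y = tadd L x (unit_site i 1)) + of_bool (y = tadd L x (unit_site i (L - 1))))
      = (\<Sum>i<d. of_bool (y = x(i := p i)) + of_bool (y = x(i := m i)) :: complex)"
    by (intro sum.cong refl) (simp add: tadd_unit[OF x] p_def m_def)
  show ?thesis
  proof (cases "dist1 d L x y = 1")
    case True
    then obtain i where i: "i < d" "y = x(i := p i) \<or> y = x(i := m i)" using D by blast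
    have ne: "y \<noteq> x(j := c)" if "j \<noteq> i" "j < d" for j c
    proof
      assume "y = x(j := c)"
      then have "y i = x i" using that by simp
      then show False using i(2) pm[OF i(1)] by auto
    qed
    have "(\<Sum>j<d. of_bool (y = x(j := p j)) + of_bool (y = x(j := m j)) :: complex)
        = (\<Sum>j<d. if j = i then 1 else 0)"
    proof (intro sum.cong refl)
      fix j assume "j \<in> {..<d}"
      show "of_bool (y = x(j := p j)) + of_bool (y = x(j := m j)) = (if j = i then 1 else (0::complex))"
      proof (cases "j = i")
        case True
        have "x(i := p i) \<noteq> x(i := m i)" using pm(3)[OF i(1)] by (metis fun_upd_same)
        then show ?thesis using i(2) True by auto
      next
        case False
        then show ?thesis using ne[OF False] \<open>j \<in> {..<d}\<close> by simp
      qed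
    qed
    then show ?thesis using R i(1) True x y by (simp add: hopping_def)
  next
    case False
    then have "y \<noteq> x(j := p j)" "y \<noteq> x(j := m j)" if "j < d" for j using D that by auto
    then have "(\<Sum>j<d. of_bool (y = x(j := p j)) + of_bool (y = x(j := m j)) :: complex) = 0"
      by (intro sum.neutral) auto
    then show ?thesis using R False by (simp add: hopping_def)
  qed
qed

lemma mvec_hopping:
  assumes L: "L \<ge> 3" and x: "x \<in> lattice d L"
  shows "mvec (lattice d L) (hopping d L) v x =
    (\<Sum>i<d. v (tadd L x (unit_site i 1)) + v (tadd L x (unit_site i (L - 1))))"
proof -
  let ?\<Lambda> = "lattice d L"
  have *: "(\<Sum>y\<in>?\<Lambda>. of_bool (y = z) * v y) = v z" if "z \<in> ?\<Lambda>" for z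
  proof -
    have "(\<Sum>y\<in>?\<Lambda>. of_bool (y = z) * v y) = (\<Sum>y\<in>?\<Lambda>. if y = z then v z else 0)"
      by (intro sum.cong) auto
    then show ?thesis using that by simp
  qed
  have "mvec ?\<Lambda> (hopping d L) v x = (\<Sum>y\<in>?\<Lambda>. \<Sum>i<d. of_bool (y = tadd L x (unit_site i 1)) * v y
      + of_bool (y = tadd L x (unit_site i (L - 1))) * v y)"
    unfolding mvec_def
    by (intro sum.cong refl) (simp add: hopping_eq[OF L x] sum_distrib_right distrib_right)
  also have "\<dots> = (\<Sum>i<d. v (tadd L x (unit_site i 1)) + v (tadd L x (unit_site i (L - 1))))"
    by (subst sum.swap, intro sum.cong refl)
      (use L x in \<open>simp add: sum.distrib * tadd_in_lattice unit_in_lattice\<close>)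
  finally show ?thesis .
qed

lemma hopping_sym: "hopping d L x y = hopping d L y x"
  by (simp add: hopping_def dist1_def cdist_def min.commute conj_ac)

lemma hermitian_Kmu: "hermitian (lattice d L) (Kmu d L \<mu>)"
proof (rule hermitianI)
  show "Kmu d L \<mu> x y = 0" if "x \<notin> lattice d L \<or> y \<notin> lattice d L" for x y
    using that by (auto simp: Kmu_def laplacian_def hopping_def idm_def)
  have "cnj (hopping d L x y) = hopping d L x y" "cnj (idm (lattice d L) x y) = idm (lattice d L) x y"
    "idm (lattice d L) x y = idm (lattice d L) y x" for x y
    by (auto simp: hopping_def idm_def)
  then show "Kmu d L \<mu> y x = cnj (Kmu d L \<mu> x y)" for x y
    by (simp add: Kmu_def laplacian_def hopping_sym[of d L x y])
qed

text \<open>Dispersion relation of \<open>-\<Delta>\<close>: its eigenvalue on the plane wave of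
  momentum \<open>2 * pi * k / L\<close>, with values between 0 and 4 d.\<close>

definition disp :: "nat \<Rightarrow> nat \<Rightarrow> site \<Rightarrow> real" where
  "disp d L k = (\<Sum>i<d. 2 - 2 * cos (2 * pi * real (k i) / real L))"

text \<open>Modulo L the exponent \<open>m * (L - 1)\<close> is -m, so the second term is the
  complex conjugate of the first.\<close>

lemma zeta_plus_inverse:
  assumes "L > 0"
  shows "zeta L ^ m + zeta L ^ (m * (L - 1)) = of_real (2 * cos (2 * pi * real m / real L))"
proof -
  have "zeta L ^ m * zeta L ^ (m * (L - 1)) = zeta L ^ (m * L)"
    using assms by (simp flip: power_add mult_Suc_right)
  also have "\<dots> = 1" using zeta_power_L[OF assms] by (metis mult.commute power_mult power_one)
  finally have 1: "zeta L ^ m * zeta L ^ (m * (L - 1)) = 1" .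
  have 2: "zeta L ^ m * cnj (zeta L ^ m) = 1" using complex_norm_square[of "zeta L ^ m"] by simp
  have "zeta L ^ (m * (L - 1)) = cnj (zeta L ^ m)"
    using 1 2 by (metis mult_cancel_left mult_zero_left zero_neq_one)
  then show ?thesis unfolding zeta_power by (simp add: complex_eq_iff)
qed

lemma mvec_Kmu_pw:
  assumes L: "L \<ge> 3"
  shows "mvec (lattice d L) (Kmu d L \<mu>) (pw d L k) = (\<lambda>x. of_real (disp d L k - \<mu>) * pw d L k x)"
proof
  fix x
  let ?\<Lambda> = "lattice d L"
  show "mvec ?\<Lambda> (Kmu d L \<mu>) (pw d L k) x = of_real (disp d L k - \<mu>) * pw d L k x"
  proof (cases "x \<in> ?\<Lambda>")
    case False
    then have "mvec ?\<Lambda> (Kmu d L \<mu>) (pw d L k) x = 0"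
      unfolding mvec_def using hermitian_outside[OF hermitian_Kmu] by (intro sum.neutral) auto
    then show ?thesis using False by (simp add: pw_def)
  next
    case x: True
    have sh: "pw d L k (tadd L x (unit_site i c)) = zeta L ^ (k i * c) * pw d L k x"
      if "i < d" "c < L" for i c
      using that L x by (simp add: pw_def tadd_in_lattice unit_in_lattice phase_tadd phase_unit)
    have "mvec ?\<Lambda> (Kmu d L \<mu>) (pw d L k) x
      = - mvec ?\<Lambda> (hopping d L) (pw d L k) x + (2 * of_nat d - of_real \<mu>) * mvec ?\<Lambda> (idm ?\<Lambda>) (pw d L k) x"
      unfolding mvec_def sum_distrib_left sum_negf[symmetric] sum.distrib[symmetric]
      by (intro sum.cong refl) (simp add: Kmu_def laplacian_def algebra_simps)
    also have "mvec ?\<Lambda> (idm ?\<Lambda>) (pw d L k) x = pw d L k x"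
      using x by (simp add: mvec_idm)
    also have "mvec ?\<Lambda> (hopping d L) (pw d L k) x
        = (\<Sum>i<d. (zeta L ^ k i + zeta L ^ (k i * (L - 1))) * pw d L k x)"
      unfolding mvec_hopping[OF L x]
      by (intro sum.cong refl) (use L in \<open>simp add: sh distrib_right\<close>)
    also have "\<dots> = of_real (\<Sum>i<d. 2 * cos (2 * pi * real (k i) / real L)) * pw d L k x"
    proof -
      have "L > 0" using L by simp
      then show ?thesis by (simp only: zeta_plus_inverse of_real_sum sum_distrib_right)
    qed
    also have "(\<Sum>i<d. 2 * cos (2 * pi * real (k i) / real L)) = 2 * real d - disp d L k"
      by (simp add: disp_def sum_subtractf)
    finally show ?thesis by (simp add: algebra_simps)
  qed
qed

lemma eigenbasis_Kmu:
  assumes "L \<ge> 3"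
  shows "eigenbasis (lattice d L) (pw d L) (Kmu d L \<mu>) (\<lambda>k. disp d L k - \<mu>)"
proof -
  interpret onb "lattice d L" "pw d L" using assms by (intro onb_pw) simp
  show ?thesis
    by unfold_locales (use assms in \<open>simp_all add: hermitian_Kmu mvec_Kmu_pw\<close>)
qed

section \<open>Momenta on both sides of the Fermi level\<close>

lemma abs_cos_diff_le: "\<bar>cos a - cos b\<bar> \<le> \<bar>a - b\<bar>" for a b :: real
proof -
  have "\<bar>cos a - cos b\<bar> = 2 * \<bar>sin ((a + b) / 2)\<bar> * \<bar>sin ((b - a) / 2)\<bar>"
    by (simp add: cos_diff_cos abs_mult)
  also have "\<dots> \<le> 2 * 1 * \<bar>(b - a) / 2\<bar>"
    by (intro mult_mono abs_sin_x_le_abs_x) auto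
  finally show ?thesis by simp
qed

text \<open>The path \<open>k = t(\<pi> - q)\<close> joins \<open>0\<close> to a point where \<open>k + q\<close> is the maximum of the dispersion
  relation. Along it the dispersion at \<open>k + q\<close> exceeds the one at \<open>k\<close> by
  \<open>\<Sum> 4 sin m sin (q/2)\<close> with midpoint \<open>m = k + q/2 \<in> [0, \<pi>]\<close>.\<close>

lemma exists_momentum_across_level:
  fixes q :: "nat \<Rightarrow> real"
  assumes q: "\<And>i. i < d \<Longrightarrow> 0 \<le> q i \<and> q i \<le> 2 * pi"
    and j: "j < d" "1 \<le> 2 - 2 * cos (q j)"
    and \<delta>: "\<delta> \<le> 1 / 2" "\<delta> \<le> \<mu>" "\<delta> \<le> 4 * real d - \<mu>"
  shows "\<exists>k. (\<Sum>i<d. 2 - 2 * cos (k i)) \<le> \<mu> - \<delta> \<and> \<mu> + \<delta> \<le> (\<Sum>i<d. 2 - 2 * cos (k i + q i))"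
proof -
  define f where "f t = (\<Sum>i<d. 2 - 2 * cos (q i + t * (pi - q i)))" for t
  show ?thesis
  \<comment> \<open>If q itself already lies above the level, k = 0 at the bottom of the band is a
    partner. Otherwise t is chosen so that the shifted momentum has dispersion exactly \<mu> +
    \<delta>.\<close>
  proof (cases "\<mu> + \<delta> \<le> f 0")
    case True
    then show ?thesis using \<delta> by (intro exI[of _ "\<lambda>_. 0"]) (simp add: f_def)
  next
    case False
    have "f 1 = 4 * real d" by (simp add: f_def)
    moreover have "continuous_on {0..1} f"
      unfolding f_def by (intro continuous_intros)
    ultimately obtain t where t: "0 \<le> t" "t \<le> 1" "f t = \<mu> + \<delta>"
      using IVT'[of f 0 "\<mu> + \<delta>" 1] False \<delta> by force
    define k where "k i = t * (pi - q i)" for i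
    define m where "m i = k i + q i / 2" for i
    have m: "0 \<le> m i" "m i \<le> pi" if "i < d" for i
    proof -
      have "m i = (1 - t) * (q i / 2) + t * (pi - q i / 2)"
        by (simp add: m_def k_def field_simps)
      moreover have "0 \<le> (1 - t) * (q i / 2)" "0 \<le> t * (pi - q i / 2)"
        "(1 - t) * (q i / 2) \<le> (1 - t) * pi" "t * (pi - q i / 2) \<le> t * pi"
        using t q[OF that] by (intro mult_nonneg_nonneg mult_left_mono; simp)+
      moreover have "(1 - t) * pi + t * pi = pi" by (simp add: algebra_simps)
      ultimately show "0 \<le> m i" "m i \<le> pi" by linarith+
    qed
    have diff: "cos (k i) - cos (k i + q i) = 2 * sin (m i) * sin (q i / 2)" for i
      by (simp add: cos_diff_cos m_def add_divide_distrib)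
    have sinq: "0 \<le> sin (q i / 2)" if "i < d" for i
      using q[OF that] by (intro sin_ge_zero) auto
    \<comment> \<open>The midpoint \<open>m j\<close> stays between \<open>q j / 2\<close> and
      \<open>pi - q j / 2\<close>. Hence the j-th term of the difference is at least 4 sin^2(q j /
      2) = 2 - 2 cos(q j), which is at least 1 and so at least 2 \<delta>.\<close>
    have "sin (q j / 2) \<le> sin (m j)"
    proof -
      have e: "m j - pi / 2 = (1 - 2 * t) * (q j / 2 - pi / 2)"
        by (simp add: m_def k_def field_simps)
      have "\<bar>m j - pi / 2\<bar> = \<bar>1 - 2 * t\<bar> * \<bar>q j / 2 - pi / 2\<bar>"
        unfolding e abs_mult ..
      also have "\<dots> \<le> 1 * \<bar>q j / 2 - pi / 2\<bar>"
        using t by (intro mult_right_mono) auto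
      finally have "\<bar>m j - pi / 2\<bar> \<le> \<bar>q j / 2 - pi / 2\<bar>" by simp
      moreover have "\<bar>q j / 2 - pi / 2\<bar> \<le> pi"
        using q[OF j(1)] by (auto simp: abs_if)
      ultimately have "cos \<bar>q j / 2 - pi / 2\<bar> \<le> cos \<bar>m j - pi / 2\<bar>"
        by (intro cos_monotone_0_pi_le) auto
      moreover have "cos \<bar>a - pi / 2\<bar> = sin a" for a
        by (simp add: cos_diff)
      ultimately show ?thesis by simp
    qed
    then have "4 * (sin (q j / 2) * sin (q j / 2)) \<le> 4 * (sin (m j) * sin (q j / 2))"
      using sinq[OF j(1)] by (intro mult_left_mono mult_right_mono) auto
    moreover have "2 - 2 * cos (q j) = 4 * (sin (q j / 2) * sin (q j / 2))"
      using cos_double_sin[of "q j / 2"] by (simp add: power2_eq_square)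
    ultimately have gap: "1 \<le> 4 * sin (m j) * sin (q j / 2)" using j(2) by simp
    have "4 * sin (m j) * sin (q j / 2) \<le> (\<Sum>i<d. 4 * sin (m i) * sin (q i / 2))"
      by (rule member_le_sum[of j "{..<d}" "\<lambda>i. 4 * sin (m i) * sin (q i / 2)"])
        (use j m in \<open>auto intro!: mult_nonneg_nonneg sin_ge_zero[OF m] sinq\<close>)
    also have "\<dots> = (\<Sum>i<d. 2 * (cos (k i) - cos (k i + q i)))"
      unfolding diff by (simp add: algebra_simps)
    also have "\<dots> = (\<Sum>i<d. 2 - 2 * cos (k i + q i)) - (\<Sum>i<d. 2 - 2 * cos (k i))"
      by (simp add: sum_subtractf sum_distrib_left algebra_simps)
    finally have "1 \<le> (\<Sum>i<d. 2 - 2 * cos (k i + q i)) - (\<Sum>i<d. 2 - 2 * cos (k i))"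
      using gap by linarith
    moreover have "(\<Sum>i<d. 2 - 2 * cos (k i + q i)) = \<mu> + \<delta>"
      using t(3) by (simp add: f_def k_def add.commute)
    ultimately show ?thesis using \<delta>(1) by (intro exI[of _ k]) auto
  qed
qed

lemma cos_mod_int:
  assumes "L > 0"
  shows "cos (2 * pi * real_of_int (j mod int L) / real L) = cos (2 * pi * real_of_int j / real L)"
proof -
  have "real_of_int j = real L * real_of_int (j div int L) + real_of_int (j mod int L)"
    by (metis mult_div_mod_eq of_int_add of_int_mult of_int_of_nat_eq)
  then have "2 * pi * real_of_int j / real L
      = 2 * pi * real_of_int (j mod int L) / real L + 2 * pi * real_of_int (j div int L)"
    using assms by (simp add: field_simps)
  then show ?thesis by (simp add: cos_add)
qed

lemma cos_mod_nat:
  assumes "L > 0"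
  shows "cos (2 * pi * real (j mod L) / real L) = cos (2 * pi * real j / real L)"
  using cos_mod_int[OF assms, of "int j"] by (simp flip: of_nat_mod)

text \<open>Around the real momentum given by \<open>exists_momentum_across_level\<close>, a whole
  box of lattice momenta works, at the price of half of \<delta>. Each coordinate moves by at most 4
  pi \<rho>, and 2 - 2 cos has Lipschitz constant 2, so the dispersion moves by at most 8 pi d
  \<rho> = \<delta>/2; this fixes \<rho>.\<close>

lemma card_momenta_across_level:
  assumes q: "q \<in> lattice d L"
    and j: "j < d" "1 \<le> 2 - 2 * cos (2 * pi * real (q j) / real L)"
    and \<delta>: "0 < \<delta>" "\<delta> \<le> 1 / 2" "\<delta> \<le> \<mu>" "\<delta> \<le> 4 * real d - \<mu>"
    and \<rho>: "\<rho> = \<delta> / (16 * pi * real d)" and L: "1 \<le> \<rho> * real L"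
  shows "\<rho> ^ d * card (lattice d L)
    \<le> card {k \<in> lattice d L. disp d L k \<le> \<mu> - \<delta> / 2 \<and> \<mu> + \<delta> / 2 \<le> disp d L (tadd L k q)}"
proof -
  have d: "d > 0" using j by simp
  have \<rho>0: "0 < \<rho>" using \<delta> d by (simp add: \<rho>)
  have L0: "L > 0" using L by (cases L) auto
  have ql: "q i < L" if "i < d" for i using q that by (simp add: lattice_def)
  define qr where "qr i = 2 * pi * real (q i) / real L" for i
  have qr: "0 \<le> qr i \<and> qr i \<le> 2 * pi" if "i < d" for i
    using ql[OF that] by (simp add: qr_def field_simps)
  obtain k where k: "(\<Sum>i<d. 2 - 2 * cos (k i)) \<le> \<mu> - \<delta>"
    "\<mu> + \<delta> \<le> (\<Sum>i<d. 2 - 2 * cos (k i + qr i))"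
    using exists_momentum_across_level[of d qr j \<delta> \<mu>] qr j \<delta> by (auto simp: qr_def)
  define a where "a i = \<lfloor>k i * real L / (2 * pi)\<rfloor>" for i
  \<comment> \<open>Side length of the box. Since \<rho> L >= 1, rounding up at most doubles it, and
    it still exceeds every offset t by one, which absorbs the rounding error of
    \<open>a\<close>.\<close>
  define M where "M = nat \<lceil>\<rho> * real L\<rceil>"
  have M1: "\<rho> * real L \<le> real M" "real M \<le> 2 * \<rho> * real L"
    unfolding M_def using L by linarith+
  have "\<rho> \<le> 1 / 2"
  proof -
    have "1 * 1 \<le> pi * real d" using d pi_ge_two by (intro mult_mono) auto
    then have "\<delta> \<le> 1 / 2 * (16 * pi * real d)" using \<delta>(2) by simp
    then show ?thesis unfolding \<rho> using d by (simp add: divide_le_eq)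
  qed
  then have M_le: "M \<le> L"
  proof -
    have "2 * \<rho> * real L \<le> 1 * real L" using \<open>\<rho> \<le> 1 / 2\<close> by (intro mult_right_mono) auto
    then show ?thesis using M1(2) by simp
  qed
  \<comment> \<open>The box starts at the integer point below the real momentum, possibly negative
    or beyond L; reduction modulo L returns to the lattice without changing any cosine, and stays
    injective because M <= L.\<close>
  define \<kappa> where "\<kappa> t = (\<lambda>i. if i < d then nat ((a i + int (t i)) mod int L) else 0)" for t :: site
  define err where "err = 4 * pi * \<rho>"
  have near: "\<bar>2 * pi * real_of_int (a i + int (t i)) / real L - k i\<bar> \<le> err"
    if t: "t \<in> lattice d M" and i: "i < d" for t i
  proof -
    have ti: "real (t i) + 1 \<le> real M" using t i by (auto simp: lattice_def)
    define z where "z = k i * real L / (2 * pi)"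
    have ki: "k i = 2 * pi * z / real L" using L0 by (simp add: z_def)
    have "\<bar>real_of_int (a i + int (t i)) - z\<bar> \<le> real M"
      using ti of_int_floor_le[of z] real_of_int_floor_add_one_ge[of z] unfolding a_def z_def[symmetric] by simp linarith
    also have "\<dots> \<le> 2 * \<rho> * real L" by (rule M1)
    finally have "2 * pi * \<bar>real_of_int (a i + int (t i)) - z\<bar> / real L \<le> 2 * pi * (2 * \<rho> * real L) / real L"
      by (intro divide_right_mono mult_left_mono) auto
    also have "\<dots> = err" using L0 by (simp add: err_def)
    also have "2 * pi * \<bar>real_of_int (a i + int (t i)) - z\<bar> / real L
        = \<bar>2 * pi * real_of_int (a i + int (t i)) / real L - k i\<bar>"
    proof -
      have "2 * pi * real_of_int (a i + int (t i)) / real L - k i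
          = (2 * pi / real L) * (real_of_int (a i + int (t i)) - z)"
        unfolding ki right_diff_distrib by simp
      then show ?thesis by (simp add: abs_mult)
    qed
    finally show ?thesis .
  qed
  have derr: "real d * (2 * err) = \<delta> / 2"
    using d by (simp add: err_def \<rho> field_simps)
  have close: "\<bar>(\<Sum>i<d. 2 - 2 * cos (f i)) - (\<Sum>i<d. 2 - 2 * cos (g i))\<bar> \<le> \<delta> / 2"
    if "\<And>i. i < d \<Longrightarrow> \<bar>f i - g i\<bar> \<le> err" for f g
  proof -
    have "\<bar>(\<Sum>i<d. 2 - 2 * cos (f i)) - (\<Sum>i<d. 2 - 2 * cos (g i))\<bar>
        = \<bar>\<Sum>i<d. 2 * (cos (g i) - cos (f i))\<bar>"
      by (simp add: sum_subtractf[symmetric] algebra_simps)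
    also have "\<dots> \<le> (\<Sum>i<d. \<bar>2 * (cos (g i) - cos (f i))\<bar>)" by (rule sum_abs)
    also have "\<dots> \<le> (\<Sum>i<d. 2 * err)"
    proof (rule sum_mono)
      fix i assume "i \<in> {..<d}"
      then show "\<bar>2 * (cos (g i) - cos (f i))\<bar> \<le> 2 * err"
        using abs_cos_diff_le[of "g i" "f i"] that[of i] by (simp add: abs_mult abs_minus_commute)
    qed
    also have "\<dots> = \<delta> / 2" using derr by simp
    finally show ?thesis .
  qed
  have \<kappa>_in: "\<kappa> t \<in> lattice d L" for t
    using L0 by (auto simp: \<kappa>_def lattice_def nat_less_iff)
  have \<kappa>_cos: "cos (2 * pi * real (\<kappa> t i) / real L) = cos (2 * pi * real_of_int (a i + int (t i)) / real L)"
    if "i < d" for t i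
  proof -
    have "real (\<kappa> t i) = real_of_int ((a i + int (t i)) mod int L)"
      using L0 that by (simp add: \<kappa>_def)
    then show ?thesis by (simp only: cos_mod_int[OF L0])
  qed
  have \<kappa>_cos2: "cos (2 * pi * real (tadd L (\<kappa> t) q i) / real L)
      = cos (2 * pi * real_of_int (a i + int (t i)) / real L + qr i)" if "i < d" for t i
  proof -
    have "cos (2 * pi * real (tadd L (\<kappa> t) q i) / real L) = cos (2 * pi * real (\<kappa> t i + q i) / real L)"
      unfolding tadd_def by (rule cos_mod_nat[OF L0])
    also have "real (\<kappa> t i + q i) = real_of_int ((a i + int (t i)) mod int L + int (q i))"
      using L0 that by (simp add: \<kappa>_def)
    also have "cos (2 * pi * real_of_int ((a i + int (t i)) mod int L + int (q i)) / real L)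
        = cos (2 * pi * real_of_int (((a i + int (t i)) mod int L + int (q i)) mod int L) / real L)"
      by (rule cos_mod_int[OF L0, symmetric])
    also have "((a i + int (t i)) mod int L + int (q i)) mod int L = (a i + int (t i) + int (q i)) mod int L"
      by (simp add: mod_simps)
    also have "cos (2 * pi * real_of_int ((a i + int (t i) + int (q i)) mod int L) / real L)
        = cos (2 * pi * real_of_int (a i + int (t i) + int (q i)) / real L)"
      by (rule cos_mod_int[OF L0])
    also have "2 * pi * real_of_int (a i + int (t i) + int (q i)) / real L
        = 2 * pi * real_of_int (a i + int (t i)) / real L + qr i"
      by (simp add: qr_def add_divide_distrib distrib_left)
    finally show ?thesis .
  qed
  define S where "S = {k \<in> lattice d L. disp d L k \<le> \<mu> - \<delta> / 2 \<and> \<mu> + \<delta> / 2 \<le> disp d L (tadd L k q)}"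
  have "\<kappa> ` lattice d M \<subseteq> S"
  proof
    fix s assume "s \<in> \<kappa> ` lattice d M"
    then obtain t where t: "t \<in> lattice d M" and s: "s = \<kappa> t" by auto
    let ?y = "\<lambda>i. 2 * pi * real_of_int (a i + int (t i)) / real L"
    have "disp d L s = (\<Sum>i<d. 2 - 2 * cos (?y i))"
      unfolding disp_def s by (intro sum.cong refl) (simp only: lessThan_iff \<kappa>_cos)
    moreover have "disp d L (tadd L s q) = (\<Sum>i<d. 2 - 2 * cos (?y i + qr i))"
      unfolding disp_def s by (intro sum.cong refl) (simp only: lessThan_iff \<kappa>_cos2)
    moreover have "\<bar>(\<Sum>i<d. 2 - 2 * cos (?y i)) - (\<Sum>i<d. 2 - 2 * cos (k i))\<bar> \<le> \<delta> / 2"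
      by (rule close) (rule near[OF t])
    moreover have "\<bar>(\<Sum>i<d. 2 - 2 * cos (?y i + qr i)) - (\<Sum>i<d. 2 - 2 * cos (k i + qr i))\<bar> \<le> \<delta> / 2"
      by (rule close) (use near[OF t] in simp)
    ultimately have "disp d L s \<le> \<mu> - \<delta> / 2" "\<mu> + \<delta> / 2 \<le> disp d L (tadd L s q)"
      using k by linarith+
    then show "s \<in> S" using \<kappa>_in s by (simp add: S_def)
  qed
  moreover have "inj_on \<kappa> (lattice d M)"
  proof (rule inj_onI)
    fix s t assume s: "s \<in> lattice d M" and t: "t \<in> lattice d M" and eq: "\<kappa> s = \<kappa> t"
    show "s = t"
    proof
      fix i
      show "s i = t i"
      proof (cases "i < d")
        case True
        have "nat ((a i + int (s i)) mod int L) = nat ((a i + int (t i)) mod int L)"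
          using fun_cong[OF eq, of i] True by (simp add: \<kappa>_def)
        then have "(a i + int (s i)) mod int L = (a i + int (t i)) mod int L"
          using L0 by (simp add: eq_nat_nat_iff)
        then have "int L dvd (int (s i) - int (t i))"
          by (simp add: mod_eq_dvd_iff)
        moreover have "\<bar>int (s i) - int (t i)\<bar> < int L"
          using s t True M_le by (auto simp: lattice_def abs_if)
        ultimately show ?thesis
          using zdvd_not_zless[of "\<bar>int (s i) - int (t i)\<bar>" "int L"] by auto
      qed (use s t in \<open>auto simp: lattice_def\<close>)
    qed
  qed
  ultimately have "M ^ d \<le> card S"
    using card_inj_on_le[of \<kappa> "lattice d M" S] by (simp add: card_lattice S_def)
  moreover have "(\<rho> * real L) ^ d \<le> real M ^ d"
    using M1(1) \<rho>0 by (intro power_mono) auto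
  ultimately have "(\<rho> * real L) ^ d \<le> card S"
    by (metis of_nat_le_iff of_nat_power order.trans)
  then show ?thesis by (simp add: card_lattice power_mult_distrib S_def)
qed

section \<open>Boundary energy\<close>

lemma cmod_zeta_minus_1: "(cmod (zeta L ^ m - 1))\<^sup>2 = 2 - 2 * cos (2 * pi * real m / real L)"
proof -
  define t where "t = 2 * pi * real m / real L"
  have "(cmod (zeta L ^ m - 1))\<^sup>2 = (cos t - 1)\<^sup>2 + (sin t)\<^sup>2"
    by (simp add: zeta_power cmod_power2 t_def)
  also have "\<dots> = 2 - 2 * cos t"
    using sin_cos_squared_add[of t] by (simp add: power2_diff)
  finally show ?thesis by (simp add: t_def)
qed

definition fdiff :: "nat \<Rightarrow> nat \<Rightarrow> cvec \<Rightarrow> cvec" where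
  "fdiff L i v = (\<lambda>x. v (tadd L x (unit_site i 1)) - v x)"

text \<open>Counts the bonds in direction i with exactly one end in B; written as a squared norm so
  that Parseval applies.\<close>

definition bdry :: "nat \<Rightarrow> nat \<Rightarrow> nat \<Rightarrow> site set \<Rightarrow> real" where
  "bdry d L i B = (\<Sum>x\<in>lattice d L. (cmod (fdiff L i (\<lambda>x. of_bool (x \<in> B)) x))\<^sup>2)"

lemma bdry_nonneg: "0 \<le> bdry d L i B"
  by (simp add: bdry_def sum_nonneg)

lemma ip_pw_fdiff:
  assumes L: "L \<ge> 2" and i: "i < d"
  shows "ip (lattice d L) (pw d L q) (fdiff L i v) = (zeta L ^ q i - 1) * ip (lattice d L) (pw d L q) v"
proof -
  let ?\<Lambda> = "lattice d L"
  define e where "e = unit_site i 1"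
  have e: "e \<in> ?\<Lambda>" using unit_in_lattice[OF i] L by (simp add: e_def)
  have z: "zeta L ^ q i * cnj (zeta L ^ q i) = 1"
    using complex_norm_square[of "zeta L ^ q i"] by simp
  have "cnj (pw d L q x) = zeta L ^ q i * cnj (pw d L q (tadd L x e))" if "x \<in> ?\<Lambda>" for x
  proof -
    have "pw d L q (tadd L x e) = zeta L ^ q i * pw d L q x"
      using that L i e by (simp add: pw_def tadd_in_lattice phase_tadd e_def phase_unit)
    then show ?thesis using z by (simp add: mult.assoc[symmetric])
  qed
  then have "ip ?\<Lambda> (pw d L q) (\<lambda>x. v (tadd L x e))
      = (\<Sum>x\<in>?\<Lambda>. zeta L ^ q i * (cnj (pw d L q (tadd L x e)) * v (tadd L x e)))"
    unfolding ip_def by (intro sum.cong refl) (simp add: mult.assoc)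
  also have "\<dots> = zeta L ^ q i * ip ?\<Lambda> (pw d L q) v"
    unfolding ip_def sum_distrib_left[symmetric]
    using sum_tadd[OF e, of "\<lambda>x. cnj (pw d L q x) * v x"] by simp
  finally show ?thesis
    unfolding fdiff_def e_def[symmetric] ip_diff_right by (simp add: algebra_simps)
qed

lemma sum_fdiff_sq:
  assumes L: "L \<ge> 2" and i: "i < d"
  shows "(\<Sum>x\<in>lattice d L. (cmod (fdiff L i v x))\<^sup>2) =
    (\<Sum>q\<in>lattice d L. (2 - 2 * cos (2 * pi * real (q i) / real L)) * (cmod (ip (lattice d L) (pw d L q) v))\<^sup>2)"
proof -
  interpret onb "lattice d L" "pw d L" by (rule onb_pw[OF L])
  show ?thesis
    unfolding parseval[of "fdiff L i v", symmetric] ip_pw_fdiff[OF L i]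
    by (simp add: norm_mult power_mult_distrib cmod_zeta_minus_1)
qed

text \<open>For an indicator function consecutive differences never have the same nonzero sign, so the
  second difference dominates the first one. In Fourier space this forces a fixed proportion
  of the boundary to be carried by momenta bounded away from zero.\<close>

lemma bdry_le_high_momenta:
  assumes L: "L \<ge> 2" and i: "i < d"
  shows "bdry d L i B \<le> 16 * (\<Sum>q\<in>{q\<in>lattice d L. 1 \<le> 2 - 2 * cos (2 * pi * real (q i) / real L)}.
    (cmod (ip (lattice d L) (pw d L q) (\<lambda>x. of_bool (x \<in> B))))\<^sup>2)"
proof -
  let ?\<Lambda> = "lattice d L"
  define e where "e = unit_site i 1"
  have e: "e \<in> ?\<Lambda>" using unit_in_lattice[OF i] L by (simp add: e_def)
  define v :: cvec where "v = (\<lambda>x. of_bool (x \<in> B))"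
  define D where "D = fdiff L i v"
  define s where "s q = 2 - 2 * cos (2 * pi * real (q i) / real L)" for q :: site
  define w where "w q = (cmod (ip ?\<Lambda> (pw d L q) v))\<^sup>2" for q
  have s: "0 \<le> s q" "s q \<le> 4" for q
    using cos_le_one[of "2 * pi * real (q i) / real L"] cos_ge_minus_one[of "2 * pi * real (q i) / real L"]
    unfolding s_def by linarith+
  have b: "bdry d L i B = (\<Sum>x\<in>?\<Lambda>. (cmod (D x))\<^sup>2)"
    by (simp add: bdry_def D_def v_def)
  have b1: "bdry d L i B = (\<Sum>q\<in>?\<Lambda>. s q * w q)"
    unfolding b D_def sum_fdiff_sq[OF L i] s_def w_def ..
  have "(cmod (D (tadd L x e)))\<^sup>2 + (cmod (D x))\<^sup>2 \<le> (cmod (fdiff L i D x))\<^sup>2" for x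
    by (auto simp: D_def fdiff_def e_def v_def)
  then have "(\<Sum>x\<in>?\<Lambda>. (cmod (D (tadd L x e)))\<^sup>2 + (cmod (D x))\<^sup>2) \<le> (\<Sum>x\<in>?\<Lambda>. (cmod (fdiff L i D x))\<^sup>2)"
    by (rule sum_mono)
  also have "\<dots> = (\<Sum>q\<in>?\<Lambda>. s q * (s q * w q))"
    unfolding sum_fdiff_sq[OF L i] D_def ip_pw_fdiff[OF L i]
    by (simp add: norm_mult power_mult_distrib cmod_zeta_minus_1 s_def w_def)
  finally have "2 * bdry d L i B \<le> (\<Sum>q\<in>?\<Lambda>. s q * (s q * w q))"
    using sum_tadd[OF e, of "\<lambda>x. (cmod (D x))\<^sup>2"] by (simp add: sum.distrib b)
  \<comment> \<open>On modes with s < 1 the weight s^2 is at most s, which one of the two copies of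
    the boundary on the left absorbs; on the remaining modes s^2 <= 16.\<close>
  also have "\<dots> \<le> (\<Sum>q\<in>?\<Lambda>. s q * w q + 16 * (if 1 \<le> s q then w q else 0))"
  proof (rule sum_mono)
    fix q
    have w: "0 \<le> w q" by (simp add: w_def)
    show "s q * (s q * w q) \<le> s q * w q + 16 * (if 1 \<le> s q then w q else 0)"
    proof (cases "1 \<le> s q")
      case True
      have "s q * s q \<le> 4 * 4" using s by (intro mult_mono) auto
      then have "s q * s q * w q \<le> 16 * w q" using w by (intro mult_right_mono) auto
      then show ?thesis using True s w by (simp add: mult.assoc add_increasing)
    next
      case False
      then have "s q * (s q * w q) \<le> 1 * (s q * w q)" using s w by (intro mult_right_mono) auto
      then show ?thesis using False by simp
    qed
  qed
  also have "\<dots> = bdry d L i B + 16 * (\<Sum>q\<in>{q\<in>?\<Lambda>. 1 \<le> s q}. w q)"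
    by (simp add: sum.distrib b1 sum_distrib_left[symmetric] sum.If_cases Int_def)
  finally show ?thesis by (simp add: s_def w_def v_def)
qed

text \<open>Multiplication by an indicator is a convolution in momentum space, so the matrix element
  depends on the momentum transfer q alone, not on k.\<close>

lemma cutoff_matrix_element:
  assumes L: "L \<ge> 2" and k: "k \<in> lattice d L" and q: "q \<in> lattice d L"
  shows "(cmod (ip (lattice d L) (pw d L k) (\<lambda>x. of_bool (x \<in> B) * pw d L (tadd L q k) x)))\<^sup>2
    = (cmod (ip (lattice d L) (pw d L q) (\<lambda>x. of_bool (x \<in> B))))\<^sup>2 / card (lattice d L)"
proof -
  let ?\<Lambda> = "lattice d L"
  let ?s = "complex_of_real (sqrt (real (L ^ d)))"
  have "ip ?\<Lambda> (pw d L k) (\<lambda>x. of_bool (x \<in> B) * pw d L (tadd L q k) x)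
      = (\<Sum>x\<in>?\<Lambda>. cnj (cnj (pw d L q x) * of_bool (x \<in> B)) / ?s)"
    unfolding ip_def
  proof (intro sum.cong refl)
    fix x assume x: "x \<in> ?\<Lambda>"
    have p: "phase d L (tadd L q k) x = phase d L q x * phase d L k x"
      using L by (simp add: phase_commute[of d L _ x] phase_tadd)
    have "cnj (phase d L k x) * phase d L k x = 1"
      using complex_norm_square[of "phase d L k x"] by (simp add: mult.commute)
    then have c: "cnj (phase d L k x) * (phase d L q x * phase d L k x) = phase d L q x"
      by (metis mult.left_commute mult.right_neutral)
    have "cnj (phase d L k x / ?s) * (phase d L (tadd L q k) x / ?s) = phase d L q x / ?s / ?s"
      unfolding p by (simp add: c)
    then show "cnj (pw d L k x) * (of_bool (x \<in> B) * pw d L (tadd L q k) x)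
        = cnj (cnj (pw d L q x) * of_bool (x \<in> B)) / ?s"
      using x by (simp add: pw_def)
  qed
  also have "\<dots> = cnj (ip ?\<Lambda> (pw d L q) (\<lambda>x. of_bool (x \<in> B))) / ?s"
    by (simp only: ip_def cnj_sum sum_divide_distrib)
  finally show ?thesis
    by (simp add: norm_divide power_divide card_lattice)
qed

text \<open>Grouped by transfer, the weight of q is its squared Fourier coefficient times the
  fraction of k for which k lies below and k + q above the level. This fraction is at least \<rho>^d
  as soon as the i-th component of q is bounded away from zero, and such q carry 1/16 of the
  boundary.\<close>

lemma sum_cutoff_ge:
  assumes L: "L \<ge> 2" and i: "i < d"
    and \<delta>: "0 < \<delta>" "\<delta> \<le> 1 / 2" "\<delta> \<le> \<mu>" "\<delta> \<le> 4 * real d - \<mu>"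
    and \<rho>: "\<rho> = \<delta> / (16 * pi * real d)" and L1: "1 \<le> \<rho> * real L"
  shows "\<rho> ^ d / 16 * bdry d L i B \<le>
    (\<Sum>k\<in>{k\<in>lattice d L. disp d L k - \<mu> \<le> - (\<delta> / 2)}. \<Sum>l\<in>{l\<in>lattice d L. \<delta> / 2 \<le> disp d L l - \<mu>}.
      (cmod (ip (lattice d L) (pw d L k) (\<lambda>x. of_bool (x \<in> B) * pw d L l x)))\<^sup>2)"
proof -
  let ?\<Lambda> = "lattice d L"
  let ?n = "real (card ?\<Lambda>)"
  define F where "F = {k\<in>?\<Lambda>. disp d L k - \<mu> \<le> - (\<delta> / 2)}"
  define U where "U = {l\<in>?\<Lambda>. \<delta> / 2 \<le> disp d L l - \<mu>}"
  define H where "H = {q\<in>?\<Lambda>. 1 \<le> 2 - 2 * cos (2 * pi * real (q i) / real L)}"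
  define w where "w q = (cmod (ip ?\<Lambda> (pw d L q) (\<lambda>x. of_bool (x \<in> B))))\<^sup>2" for q
  define c where "c k l = (cmod (ip ?\<Lambda> (pw d L k) (\<lambda>x. of_bool (x \<in> B) * pw d L l x)))\<^sup>2" for k l
  have w: "0 \<le> w q" for q by (simp add: w_def)
  have n: "?n > 0" using L by (simp add: card_lattice)
  have cancel: "a * N * (b / N) = a * b" if "0 < N" for a b N :: real
    using that by simp
  have "(\<Sum>k\<in>F. \<Sum>l\<in>U. c k l) = (\<Sum>k\<in>F. \<Sum>l\<in>?\<Lambda>. if l \<in> U then c k l else 0)"
    by (rule sum.cong[OF refl], rule sum.mono_neutral_cong_left) (auto simp: U_def)
  \<comment> \<open>For fixed k the upper momentum l is replaced by the transfer q with l = q + k, a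
    translation of the torus.\<close>
  also have "\<dots> = (\<Sum>k\<in>F. \<Sum>q\<in>?\<Lambda>. if tadd L q k \<in> U then c k (tadd L q k) else 0)"
    by (rule sum.cong[OF refl], rule sum_tadd[symmetric, of _ d L "\<lambda>l. if l \<in> U then c _ l else 0"])
      (simp add: F_def)
  also have "\<dots> = (\<Sum>k\<in>F. \<Sum>q\<in>?\<Lambda>. if tadd L q k \<in> U then w q / ?n else 0)"
    by (intro sum.cong refl) (auto simp: c_def w_def F_def cutoff_matrix_element[OF L])
  also have "\<dots> = (\<Sum>q\<in>?\<Lambda>. \<Sum>k\<in>F. if tadd L q k \<in> U then w q / ?n else 0)"
    by (rule sum.swap)
  also have "\<dots> \<ge> (\<Sum>q\<in>H. \<Sum>k\<in>F. if tadd L q k \<in> U then w q / ?n else 0)"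
    by (rule sum_mono2) (use w in \<open>auto simp: H_def intro!: sum_nonneg\<close>)
  finally have "(\<Sum>q\<in>H. \<Sum>k\<in>F. if tadd L q k \<in> U then w q / ?n else 0) \<le> (\<Sum>k\<in>F. \<Sum>l\<in>U. c k l)" .
  moreover have "(\<Sum>q\<in>H. \<rho> ^ d * w q) \<le> (\<Sum>q\<in>H. \<Sum>k\<in>F. if tadd L q k \<in> U then w q / ?n else 0)"
  proof (rule sum_mono)
    fix q assume "q \<in> H"
    then have q: "q \<in> ?\<Lambda>" "1 \<le> 2 - 2 * cos (2 * pi * real (q i) / real L)"
      by (auto simp: H_def)
    define S where "S = {k \<in> ?\<Lambda>. disp d L k \<le> \<mu> - \<delta> / 2 \<and> \<mu> + \<delta> / 2 \<le> disp d L (tadd L k q)}"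
    have "S \<subseteq> {k\<in>F. tadd L q k \<in> U}"
    proof
      fix k assume k: "k \<in> S"
      have "tadd L q k = tadd L k q" by (simp add: tadd_def add.commute)
      then show "k \<in> {k\<in>F. tadd L q k \<in> U}"
        using k q tadd_in_lattice[of q d L k] by (auto simp: S_def F_def U_def)
    qed
    then have "card S \<le> card {k\<in>F. tadd L q k \<in> U}"
      by (intro card_mono) (auto simp: F_def)
    moreover have "\<rho> ^ d * ?n \<le> card S"
      unfolding S_def by (rule card_momenta_across_level[OF q(1) i q(2) \<delta> \<rho> L1])
    ultimately have "\<rho> ^ d * ?n \<le> card {k\<in>F. tadd L q k \<in> U}" by linarith
    then have "\<rho> ^ d * ?n * (w q / ?n) \<le> card {k\<in>F. tadd L q k \<in> U} * (w q / ?n)"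
      using w by (intro mult_right_mono) auto
    also have "\<dots> = (\<Sum>k\<in>F. if tadd L q k \<in> U then w q / ?n else 0)"
      by (simp add: sum.If_cases F_def Int_def conj_ac)
    finally show "\<rho> ^ d * w q \<le> (\<Sum>k\<in>F. if tadd L q k \<in> U then w q / ?n else 0)"
      unfolding cancel[OF n] .
  qed
  ultimately have "\<rho> ^ d * (\<Sum>q\<in>H. w q) \<le> (\<Sum>k\<in>F. \<Sum>l\<in>U. c k l)"
    unfolding sum_distrib_left by (rule order.trans[rotated])
  moreover have "\<rho> ^ d / 16 * bdry d L i B \<le> \<rho> ^ d / 16 * (16 * (\<Sum>q\<in>H. w q))"
    using bdry_le_high_momenta[OF L i, of B] \<delta> \<rho>
    by (intro mult_left_mono) (auto simp: H_def w_def)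
  ultimately show ?thesis by (simp add: F_def U_def c_def)
qed

section \<open>Bulk and surface energy of a cut-off density matrix\<close>

definition band_energy :: "nat \<Rightarrow> nat \<Rightarrow> real \<Rightarrow> real" where
  "band_energy d L \<mu> = (\<Sum>k\<in>lattice d L. min (disp d L k - \<mu>) 0)"

text \<open>Extensivity of the filled band. The count of momenta across the level, applied to one
  transfer, already yields a positive fraction of levels at depth \<delta>/2; evenness of L supplies
  the transfer pi in the first direction.\<close>

lemma band_energy_le:
  assumes L: "L \<ge> 2" "even L" and d: "0 < d"
    and \<delta>: "0 < \<delta>" "\<delta> \<le> 1 / 2" "\<delta> \<le> \<mu>" "\<delta> \<le> 4 * real d - \<mu>"
    and \<rho>: "\<rho> = \<delta> / (16 * pi * real d)" and L1: "1 \<le> \<rho> * real L"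
  shows "band_energy d L \<mu> \<le> - (\<delta> / 2 * \<rho> ^ d * card (lattice d L))"
proof -
  let ?\<Lambda> = "lattice d L"
  define q where "q = unit_site 0 (L div 2)"
  have q: "q \<in> ?\<Lambda>" using unit_in_lattice[OF d, of "L div 2" L] L by (simp add: q_def)
  have "2 * pi * real (L div 2) / real L = pi"
    using L by (simp add: real_of_nat_div)
  then have q2: "1 \<le> 2 - 2 * cos (2 * pi * real (q 0) / real L)"
    by (simp add: q_def unit_site_def)
  define S where "S = {k \<in> ?\<Lambda>. disp d L k \<le> \<mu> - \<delta> / 2 \<and> \<mu> + \<delta> / 2 \<le> disp d L (tadd L k q)}"
  have "band_energy d L \<mu> \<le> (\<Sum>k\<in>?\<Lambda>. if k \<in> S then - (\<delta> / 2) else 0)"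
    unfolding band_energy_def by (intro sum_mono) (auto simp: S_def)
  also have "\<dots> = - (\<delta> / 2) * card S"
    by (simp add: sum.If_cases S_def Int_def)
  also have "\<dots> \<le> - (\<delta> / 2) * (\<rho> ^ d * card ?\<Lambda>)"
    unfolding S_def
    by (intro mult_left_mono_neg card_momenta_across_level[OF q d q2 \<delta> \<rho> L1]) (use \<delta> in auto)
  finally show ?thesis by simp
qed

text \<open>Each direction separately bounds the same excess X from below, with constant
  (\<delta>/4)(\<rho>^d/16); averaging over the d directions gives the stated constant.\<close>

lemma energy_restr_bdry:
  assumes L: "L \<ge> 3" and d: "0 < d"
    and \<delta>: "0 < \<delta>" "\<delta> \<le> 1 / 2" "\<delta> \<le> \<mu>" "\<delta> \<le> 4 * real d - \<mu>"
    and \<rho>: "\<rho> = \<delta> / (16 * pi * real d)" and L1: "1 \<le> \<rho> * real L"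
    and g: "density_matrix (lattice d L) g" and B: "B \<subseteq> lattice d L"
  shows "card B / card (lattice d L) * band_energy d L \<mu>
      + \<delta> * \<rho> ^ d / (64 * real d) * (\<Sum>i<d. bdry d L i B)
    \<le> Re (mtrace (lattice d L) (mmul (lattice d L) (Kmu d L \<mu>) (restr B g)))"
proof -
  let ?\<Lambda> = "lattice d L"
  interpret eigenbasis ?\<Lambda> "pw d L" "Kmu d L \<mu>" "\<lambda>k. disp d L k - \<mu>"
    by (rule eigenbasis_Kmu[OF L])
  define T where "T = Re (mtrace ?\<Lambda> (mmul ?\<Lambda> (Kmu d L \<mu>) (restr B g)))"
  define X where "X = T - card B / card ?\<Lambda> * band_energy d L \<mu>"
  have "\<delta> * \<rho> ^ d / 64 * bdry d L i B \<le> X" if i: "i < d" for i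
  proof -
    have "card B / card ?\<Lambda> * band_energy d L \<mu> + \<delta> / 2 / 2 *
      (\<Sum>k\<in>{k\<in>?\<Lambda>. disp d L k - \<mu> \<le> - (\<delta> / 2)}. \<Sum>l\<in>{l\<in>?\<Lambda>. \<delta> / 2 \<le> disp d L l - \<mu>}.
        (cmod (ip ?\<Lambda> (pw d L k) (\<lambda>x. of_bool (x \<in> B) * pw d L l x)))\<^sup>2) \<le> T"
      using energy_restr_ge[OF g B, of "\<delta> / 2"] \<delta> L pw_norm[of L]
      by (simp add: T_def E0_def band_energy_def)
    moreover have "\<delta> / 2 / 2 * (\<rho> ^ d / 16 * bdry d L i B) \<le> \<delta> / 2 / 2 *
      (\<Sum>k\<in>{k\<in>?\<Lambda>. disp d L k - \<mu> \<le> - (\<delta> / 2)}. \<Sum>l\<in>{l\<in>?\<Lambda>. \<delta> / 2 \<le> disp d L l - \<mu>}.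
        (cmod (ip ?\<Lambda> (pw d L k) (\<lambda>x. of_bool (x \<in> B) * pw d L l x)))\<^sup>2)"
      using L \<delta> by (intro mult_left_mono sum_cutoff_ge[OF _ i \<delta> \<rho> L1]) auto
    ultimately show ?thesis by (simp add: X_def)
  qed
  then have "(\<Sum>i<d. \<delta> * \<rho> ^ d / 64 * bdry d L i B) \<le> (\<Sum>i<d. X)"
    by (intro sum_mono) auto
  then have "\<delta> * \<rho> ^ d / 64 * (\<Sum>i<d. bdry d L i B) \<le> real d * X"
    by (simp add: sum_distrib_left)
  then have "\<delta> * \<rho> ^ d / (64 * real d) * (\<Sum>i<d. bdry d L i B) \<le> X"
    using d by (simp add: field_simps)
  then show ?thesis by (simp add: X_def T_def)
qed

text \<open>Connectedness of the torus, seen in Fourier space: vanishing differences kill every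
  coefficient of the indicator except the one at q = 0, so the indicator is constant.\<close>

lemma bdry_zero:
  assumes L: "L \<ge> 2" and B: "B \<subseteq> lattice d L" and z: "\<And>i. i < d \<Longrightarrow> bdry d L i B = 0"
  shows "B = {} \<or> B = lattice d L"
proof -
  let ?\<Lambda> = "lattice d L"
  interpret onb ?\<Lambda> "pw d L" by (rule onb_pw[OF L])
  define v :: cvec where "v = (\<lambda>x. of_bool (x \<in> B))"
  define o' :: site where "o' = (\<lambda>_. 0)"
  have o': "o' \<in> ?\<Lambda>" using L by (simp add: o'_def lattice_def)
  have "ip ?\<Lambda> (pw d L q) v = 0" if q: "q \<in> ?\<Lambda>" "q \<noteq> o'" for q
  proof -
    obtain i where i: "q i \<noteq> 0" using q(2) by (auto simp: o'_def)
    then have "i < d" using q(1) unfolding lattice_def by (cases "i < d") auto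
    have "fdiff L i v x = 0" if "x \<in> ?\<Lambda>" for x
      using z[OF \<open>i < d\<close>] that unfolding bdry_def v_def[symmetric]
      by (simp add: sum_nonneg_eq_0_iff)
    then have "ip ?\<Lambda> (pw d L q) (fdiff L i v) = 0" by (simp add: ip_def)
    then have "(zeta L ^ q i - 1) * ip ?\<Lambda> (pw d L q) v = 0"
      by (simp add: ip_pw_fdiff[OF L \<open>i < d\<close>])
    moreover have "zeta L ^ q i \<noteq> 1"
      using zeta_power_inj[of "q i" L 0] i q(1) L \<open>i < d\<close> by (auto simp: lattice_def)
    ultimately show ?thesis by simp
  qed
  then have "(\<Sum>q\<in>?\<Lambda>. pw d L q x * ip ?\<Lambda> (pw d L q) v)
      = (\<Sum>q\<in>?\<Lambda>. if q = o' then pw d L o' x * ip ?\<Lambda> (pw d L o') v else 0)" for x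
    by (intro sum.cong) auto
  then have "v x = pw d L o' x * ip ?\<Lambda> (pw d L o') v" if "x \<in> ?\<Lambda>" for x
    using expand[OF that, of v] o' by simp
  moreover have "pw d L o' x = pw d L o' y" if "x \<in> ?\<Lambda>" "y \<in> ?\<Lambda>" for x y
    using that by (simp add: pw_def phase_def o'_def)
  ultimately have "v x = v y" if "x \<in> ?\<Lambda>" "y \<in> ?\<Lambda>" for x y
    using that by metis
  then have "x \<in> B \<longleftrightarrow> y \<in> B" if "x \<in> ?\<Lambda>" "y \<in> ?\<Lambda>" for x y
    using that by (metis (no_types, lifting) v_def of_bool_eq_iff)
  then show ?thesis using B by blast
qed

section \<open>The two-spin problem\<close>

definition adj_count :: "nat \<Rightarrow> nat \<Rightarrow> site set \<Rightarrow> site \<Rightarrow> real" where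
  "adj_count d L A y = (\<Sum>x\<in>A. Re (hopping d L x y))"

lemma adj_count_eq:
  assumes L: "L \<ge> 3" and A: "A \<subseteq> lattice d L" and y: "y \<in> lattice d L"
  shows "adj_count d L A y = (\<Sum>i<d. of_bool (tadd L y (unit_site i 1) \<in> A)
    + of_bool (tadd L y (unit_site i (L - 1)) \<in> A))"
proof -
  have "complex_of_real (adj_count d L A y) = (\<Sum>x\<in>A. hopping d L y x)"
    unfolding adj_count_def of_real_sum
    by (intro sum.cong refl) (simp add: hopping_sym[of d L y] complex_eq_iff, simp add: hopping_def)
  also have "\<dots> = mvec (lattice d L) (hopping d L) (\<lambda>x. of_bool (x \<in> A)) y"
    unfolding mvec_def by (rule sum.mono_neutral_cong_left) (use A in auto)
  also have "\<dots> = complex_of_real (\<Sum>i<d. of_bool (tadd L y (unit_site i 1) \<in> A)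
      + of_bool (tadd L y (unit_site i (L - 1)) \<in> A))"
  proof -
    have "complex_of_real (of_bool P) = of_bool P" for P by (cases P) simp_all
    then show ?thesis unfolding mvec_hopping[OF L y] by (simp only: of_real_sum of_real_add)
  qed
  finally show ?thesis by (simp only: of_real_eq_iff)
qed

lemma adj_count_bounds:
  assumes "L \<ge> 3" "A \<subseteq> lattice d L" "y \<in> lattice d L"
  shows "0 \<le> adj_count d L A y" "adj_count d L A y \<le> 2 * real d"
proof -
  show "0 \<le> adj_count d L A y" unfolding adj_count_eq[OF assms] by (intro sum_nonneg) auto
  have "adj_count d L A y \<le> (\<Sum>i<d. 2)"
    unfolding adj_count_eq[OF assms] by (intro sum_mono) auto
  then show "adj_count d L A y \<le> 2 * real d" by simp
qed

text \<open>Forward and backward neighbours are each controlled by a full copy of the boundary,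
  because backward differences are translates of forward ones.\<close>

lemma sum_adj_count_le:
  assumes L: "L \<ge> 3" and A: "A \<subseteq> lattice d L"
  shows "(\<Sum>y\<in>lattice d L - A. adj_count d L A y) \<le> 2 * (\<Sum>i<d. bdry d L i A)"
proof -
  let ?\<Lambda> = "lattice d L"
  let ?\<chi> = "\<lambda>x. of_bool (x \<in> A) :: complex"
  have "(\<Sum>y\<in>?\<Lambda> - A. adj_count d L A y) = (\<Sum>i<d. \<Sum>y\<in>?\<Lambda> - A.
      of_bool (tadd L y (unit_site i 1) \<in> A) + of_bool (tadd L y (unit_site i (L - 1)) \<in> A))"
    by (subst sum.swap) (intro sum.cong refl adj_count_eq[OF L A], simp)
  also have "\<dots> \<le> (\<Sum>i<d. 2 * bdry d L i A)"
  proof (rule sum_mono)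
    fix i assume "i \<in> {..<d}"
    then have i: "i < d" by simp
    define e where "e = unit_site i 1"
    define f where "f = unit_site i (L - 1)"
    have e: "e \<in> ?\<Lambda>" and f: "f \<in> ?\<Lambda>"
      using unit_in_lattice[OF i] L by (simp_all add: e_def f_def)
    have ef: "tadd L (tadd L x e) f = x" if "x \<in> ?\<Lambda>" for x
      using tadd_unit_unit[OF that, of i 1 "L - 1"] tadd_unit_L[OF that] L by (simp add: e_def f_def)
    have b: "bdry d L i A = (\<Sum>x\<in>?\<Lambda>. (cmod (?\<chi> (tadd L x e) - ?\<chi> x))\<^sup>2)"
      by (simp add: bdry_def fdiff_def e_def)
    have "(\<Sum>y\<in>?\<Lambda> - A. of_bool (tadd L y e \<in> A) + of_bool (tadd L y f \<in> A))
        \<le> (\<Sum>y\<in>?\<Lambda> - A. (cmod (?\<chi> (tadd L y e) - ?\<chi> y))\<^sup>2 + (cmod (?\<chi> (tadd L y f) - ?\<chi> y))\<^sup>2)"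
      by (intro sum_mono) auto
    also have "\<dots> \<le> (\<Sum>y\<in>?\<Lambda>. (cmod (?\<chi> (tadd L y e) - ?\<chi> y))\<^sup>2 + (cmod (?\<chi> (tadd L y f) - ?\<chi> y))\<^sup>2)"
      by (intro sum_mono2) auto
    also have "(\<Sum>y\<in>?\<Lambda>. (cmod (?\<chi> (tadd L y e) - ?\<chi> y))\<^sup>2 + (cmod (?\<chi> (tadd L y f) - ?\<chi> y))\<^sup>2)
        = bdry d L i A + (\<Sum>y\<in>?\<Lambda>. (cmod (?\<chi> (tadd L y f) - ?\<chi> y))\<^sup>2)"
      unfolding b sum.distrib ..
    also have "(\<Sum>y\<in>?\<Lambda>. (cmod (?\<chi> (tadd L y f) - ?\<chi> y))\<^sup>2)
        = (\<Sum>x\<in>?\<Lambda>. (cmod (?\<chi> (tadd L (tadd L x e) f) - ?\<chi> (tadd L x e)))\<^sup>2)"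
      by (rule sum_tadd[OF e, symmetric])
    also have "\<dots> = bdry d L i A"
      unfolding b by (intro sum.cong refl) (simp add: ef norm_minus_commute)
    finally show "(\<Sum>y\<in>?\<Lambda> - A. of_bool (tadd L y (unit_site i 1) \<in> A)
      + of_bool (tadd L y (unit_site i (L - 1)) \<in> A)) \<le> 2 * bdry d L i A"
      by (simp add: e_def f_def)
  qed
  finally show ?thesis by (simp add: sum_distrib_left)
qed

lemma mtrace_restr:
  assumes "finite \<Lambda>" "A \<subseteq> \<Lambda>"
  shows "mtrace \<Lambda> (mmul \<Lambda> K (restr A g)) = (\<Sum>x\<in>A. \<Sum>y\<in>A. K x y * g y x)"
proof -
  have "mtrace \<Lambda> (mmul \<Lambda> K (restr A g)) = (\<Sum>x\<in>A. \<Sum>y\<in>\<Lambda>. K x y * restr A g y x)"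
    unfolding mtrace_def mmul_def
    by (rule sum.mono_neutral_right) (use assms in \<open>auto simp: restr_def\<close>)
  also have "\<dots> = (\<Sum>x\<in>A. \<Sum>y\<in>A. K x y * g y x)"
    by (intro sum.cong[OF refl] sum.mono_neutral_cong_right) (use assms in \<open>auto simp: restr_def\<close>)
  finally show ?thesis .
qed

text \<open>The two off-diagonal contributions are complex conjugates of each other, hence twice a
  real part.\<close>

lemma mtrace_split:
  assumes fin: "finite \<Lambda>" and A: "A \<subseteq> \<Lambda>" and K: "hermitian \<Lambda> K" and g: "hermitian \<Lambda> g"
  shows "Re (mtrace \<Lambda> (mmul \<Lambda> K g)) = Re (mtrace \<Lambda> (mmul \<Lambda> K (restr A g)))
    + Re (mtrace \<Lambda> (mmul \<Lambda> K (restr (\<Lambda> - A) g))) + 2 * (\<Sum>y\<in>\<Lambda> - A. \<Sum>x\<in>A. Re (K x y * g y x))"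
proof -
  define C where "C = \<Lambda> - A"
  have C: "C \<subseteq> \<Lambda>" by (auto simp: C_def)
  have s: "sum f \<Lambda> = sum f A + sum f C" for f :: "site \<Rightarrow> complex"
    using sum.subset_diff[OF A fin, of f] by (simp add: C_def add.commute)
  have "mtrace \<Lambda> (mmul \<Lambda> K g) = (\<Sum>x\<in>A. \<Sum>y\<in>A. K x y * g y x) + (\<Sum>x\<in>C. \<Sum>y\<in>C. K x y * g y x)
      + ((\<Sum>x\<in>A. \<Sum>y\<in>C. K x y * g y x) + (\<Sum>x\<in>C. \<Sum>y\<in>A. K x y * g y x))"
    unfolding mtrace_def mmul_def s by (simp add: sum.distrib)
  also have "(\<Sum>x\<in>A. \<Sum>y\<in>C. K x y * g y x) = (\<Sum>y\<in>C. \<Sum>x\<in>A. K x y * g y x)"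
    by (rule sum.swap)
  also have "(\<Sum>x\<in>C. \<Sum>y\<in>A. K x y * g y x) = cnj (\<Sum>y\<in>C. \<Sum>x\<in>A. K x y * g y x)"
    by (simp add: hermitian_cnj[OF K] hermitian_cnj[OF g])
  finally show ?thesis
    by (simp add: mtrace_restr[OF fin A] mtrace_restr[OF fin C] flip: C_def)
qed

lemma disp_nonneg: "0 \<le> disp d L k"
  unfolding disp_def
proof (rule sum_nonneg)
  show "0 \<le> 2 - 2 * cos (2 * pi * real (k i) / real L)" for i
    using cos_le_one[of "2 * pi * real (k i) / real L"] by linarith
qed

text \<open>Since \<open>-\<Delta>\<close> is nonnegative, a particle can lower the energy by at
  most \<mu>.\<close>

lemma energy_ge_density:
  assumes L: "L \<ge> 3" and g: "density_matrix (lattice d L) g"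
  shows "- \<mu> * (\<Sum>y\<in>lattice d L. Re (g y y)) \<le> Re (mtrace (lattice d L) (mmul (lattice d L) (Kmu d L \<mu>) g))"
proof -
  let ?\<Lambda> = "lattice d L"
  interpret eigenbasis ?\<Lambda> "pw d L" "Kmu d L \<mu>" "\<lambda>k. disp d L k - \<mu>"
    by (rule eigenbasis_Kmu[OF L])
  have "Re (mtrace ?\<Lambda> g) = (\<Sum>k\<in>?\<Lambda>. qf ?\<Lambda> g (pw d L k))"
    by (simp add: mtrace_onb qf_def)
  then have "- \<mu> * (\<Sum>y\<in>?\<Lambda>. Re (g y y)) = (\<Sum>k\<in>?\<Lambda>. - \<mu> * qf ?\<Lambda> g (pw d L k))"
    by (simp add: mtrace_def sum_distrib_left)
  also have "\<dots> \<le> (\<Sum>k\<in>?\<Lambda>. (disp d L k - \<mu>) * qf ?\<Lambda> g (pw d L k))"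
    using disp_nonneg qf_u_bounds(1)[OF g] by (intro sum_mono mult_right_mono) auto
  finally show ?thesis by (simp add: mtrace_mmul)
qed

lemma energy_restr_ge_density:
  assumes L: "L \<ge> 3" and g: "density_matrix (lattice d L) g" and C: "C \<subseteq> lattice d L"
  shows "- \<mu> * (\<Sum>y\<in>C. Re (g y y))
    \<le> Re (mtrace (lattice d L) (mmul (lattice d L) (Kmu d L \<mu>) (restr C g)))"
proof -
  have "(\<Sum>y\<in>lattice d L. Re (restr C g y y)) = (\<Sum>y\<in>C. Re (g y y))"
    by (rule sum.mono_neutral_cong_right) (use C in \<open>auto simp: restr_def\<close>)
  then show ?thesis
    using energy_ge_density[OF L restr_density_matrix(1)[OF finite_lattice g C], of \<mu>] by simp
qed

text \<open>A may be any set of sites. The block on A gets the surface estimate, the exterior block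
  only the bound -\<mu> per particle, and each bond across the interface at most 2 sqrt(r), r being
  the density at its outer end and the density at the inner end being at most 1.\<close>

lemma energy_one_spin_ge:
  assumes L: "L \<ge> 3" and d: "0 < d"
    and \<delta>: "0 < \<delta>" "\<delta> \<le> 1 / 2" "\<delta> \<le> \<mu>" "\<delta> \<le> 4 * real d - \<mu>"
    and \<rho>: "\<rho> = \<delta> / (16 * pi * real d)" and L1: "1 \<le> \<rho> * real L"
    and g: "density_matrix (lattice d L) g" and A: "A \<subseteq> lattice d L"
  shows "card A / card (lattice d L) * band_energy d L \<mu>
      + \<delta> * \<rho> ^ d / (64 * real d) * (\<Sum>i<d. bdry d L i A)
      - (\<Sum>y\<in>lattice d L - A. 2 * adj_count d L A y * sqrt (Re (g y y)) + \<mu> * Re (g y y))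
    \<le> Re (mtrace (lattice d L) (mmul (lattice d L) (Kmu d L \<mu>) g))"
proof -
  let ?\<Lambda> = "lattice d L"
  have h: "hermitian ?\<Lambda> g" using g by (simp add: density_matrix_def psd_def)
  have cross: "- (adj_count d L A y * sqrt (Re (g y y))) \<le> (\<Sum>x\<in>A. Re (Kmu d L \<mu> x y * g y x))"
    if y: "y \<in> ?\<Lambda> - A" for y
  proof -
    have "- (Re (hopping d L x y) * sqrt (Re (g y y))) \<le> Re (Kmu d L \<mu> x y * g y x)" if x: "x \<in> A" for x
    proof -
      have "x \<noteq> y" using x y by auto
      then have K: "Kmu d L \<mu> x y = - hopping d L x y"
        by (simp add: Kmu_def laplacian_def idm_def)
      have T: "0 \<le> Re (hopping d L x y)" "hopping d L x y = of_real (Re (hopping d L x y))"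
        by (auto simp: hopping_def)
      have "Re (g y x) \<le> cmod (g y x)" by (rule complex_Re_le_cmod)
      also have "\<dots> \<le> sqrt (Re (g y y) * Re (g x x))"
        using density_matrix_entry[OF _ g] x y A by auto
      also have "\<dots> \<le> sqrt (Re (g y y))"
        using density_matrix_diag[OF finite_lattice g] by (simp add: mult_left_le)
      finally have "Re (hopping d L x y) * Re (g y x) \<le> Re (hopping d L x y) * sqrt (Re (g y y))"
        using T by (intro mult_left_mono) auto
      moreover have "Re (Kmu d L \<mu> x y * g y x) = - (Re (hopping d L x y) * Re (g y x))"
        unfolding K by (subst T(2)) simp
      ultimately show ?thesis by simp
    qed
    then have "(\<Sum>x\<in>A. - (Re (hopping d L x y) * sqrt (Re (g y y)))) \<le> (\<Sum>x\<in>A. Re (Kmu d L \<mu> x y * g y x))"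
      by (rule sum_mono)
    then show ?thesis by (simp add: adj_count_def sum_distrib_right sum_negf)
  qed
  have "(\<Sum>y\<in>?\<Lambda> - A. - (adj_count d L A y * sqrt (Re (g y y))))
      \<le> (\<Sum>y\<in>?\<Lambda> - A. \<Sum>x\<in>A. Re (Kmu d L \<mu> x y * g y x))"
    by (intro sum_mono cross)
  then have "- (\<Sum>y\<in>?\<Lambda> - A. 2 * adj_count d L A y * sqrt (Re (g y y)))
      \<le> 2 * (\<Sum>y\<in>?\<Lambda> - A. \<Sum>x\<in>A. Re (Kmu d L \<mu> x y * g y x))"
    by (simp add: sum_negf sum_distrib_left[symmetric] mult.assoc)
  moreover have "- (\<Sum>y\<in>?\<Lambda> - A. \<mu> * Re (g y y))
      \<le> Re (mtrace ?\<Lambda> (mmul ?\<Lambda> (Kmu d L \<mu>) (restr (?\<Lambda> - A) g)))"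
    using energy_restr_ge_density[OF L g, of "?\<Lambda> - A" \<mu>] by (simp add: sum_distrib_left sum_negf)
  moreover note energy_restr_bdry[OF L d \<delta> \<rho> L1 g A]
  moreover note mtrace_split[OF finite_lattice A hermitian_Kmu h, of \<mu>]
  ultimately show ?thesis by (simp add: sum.distrib)
qed

section \<open>Both species: repulsion against leakage\<close>

lemma hfz_eq:
  "hfz d L \<mu> U gu gd = Re (mtrace (lattice d L) (mmul (lattice d L) (Kmu d L \<mu>) gu))
    + Re (mtrace (lattice d L) (mmul (lattice d L) (Kmu d L \<mu>) gd))
    + U * (\<Sum>x\<in>lattice d L. Re (gu x x) * Re (gd x x))"
  by (simp add: hfz_def mtrace_def mmul_def algebra_simps sum.distrib)

lemma hfz_commute: "hfz d L \<mu> U gu gd = hfz d L \<mu> U gd gu"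
  by (simp add: hfz_eq mult.commute)

text \<open>Completing the square, 2 a sqrt(r) <= W r + a^2/W. The repulsion pays for (\<mu> + W) r,
  and a^2 <= m a leaves a remainder linear in the neighbour count a, which can be summed to a
  boundary term.\<close>

lemma penalty_at_opposite_spin:
  fixes a r s U W \<eta> \<mu> :: real
  assumes "0 < W" "\<mu> + W \<le> U * \<eta>" "0 \<le> U" "0 \<le> r" "\<eta> \<le> s" "0 \<le> a" "a \<le> m"
  shows "2 * a * sqrt r + \<mu> * r \<le> U * (r * s) + m / W * a"
proof -
  have "0 \<le> (W * sqrt r - a)\<^sup>2" by simp
  then have "2 * a * sqrt r * W \<le> W * W * r + a * a"
    using assms by (simp add: power2_diff power_mult_distrib power2_eq_square[of W] power2_eq_square[of a] algebra_simps)
  also have "a * a \<le> m * a" using assms by (intro mult_right_mono) auto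
  finally have "2 * a * sqrt r \<le> W * r + m / W * a"
    using assms(1) by (simp add: field_simps)
  moreover have "(\<mu> + W) * r \<le> U * (r * s)"
  proof -
    have "(\<mu> + W) * r \<le> U * \<eta> * r" using assms by (intro mult_right_mono) auto
    also have "\<dots> \<le> U * s * r" using assms by (intro mult_right_mono mult_left_mono) auto
    finally show ?thesis by (simp add: algebra_simps)
  qed
  ultimately show ?thesis by (simp add: algebra_simps)
qed

text \<open>A site outside \<open>A \<union> B\<close> costs the bulk energy density, an interface costs boundary energy, and
  both beat the gain from leakage.\<close>

lemma hfz_ge:
  assumes L: "L \<ge> 3" "even L" and d: "0 < d"
    and \<delta>: "0 < \<delta>" "\<delta> \<le> 1 / 2" "\<delta> \<le> \<mu>" "\<delta> \<le> 4 * real d - \<mu>"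
    and \<rho>: "\<rho> = \<delta> / (16 * pi * real d)" and L1: "1 \<le> \<rho> * real L"
    and gu: "density_matrix (lattice d L) gu" and gd: "density_matrix (lattice d L) gd"
    and c: "c = \<delta> * \<rho> ^ d / (64 * real d)"
    and \<eta>: "0 < \<eta>" "2 * (4 * real d * sqrt \<eta> + \<mu> * \<eta>) \<le> \<delta> / 4 * \<rho> ^ d"
    and U: "0 \<le> U" "\<mu> + 8 * real d / c \<le> U * \<eta>"
    and A: "A = {x\<in>lattice d L. \<eta> \<le> Re (gu x x) \<and> Re (gd x x) \<le> Re (gu x x)}"
    and B: "B = {x\<in>lattice d L. \<eta> \<le> Re (gd x x) \<and> Re (gu x x) < Re (gd x x)}"
  shows "band_energy d L \<mu> + \<delta> / 4 * \<rho> ^ d * card (lattice d L - A - B)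
      + c / 2 * (\<Sum>i<d. bdry d L i A) + c / 2 * (\<Sum>i<d. bdry d L i B) \<le> hfz d L \<mu> U gu gd"
proof -
  let ?\<Lambda> = "lattice d L"
  define ru where "ru x = Re (gu x x)" for x
  define rd where "rd x = Re (gd x x)" for x
  define E where "E = ?\<Lambda> - A - B"
  define n where "n = real (card ?\<Lambda>)"
  define e0 where "e0 = \<delta> / 4 * \<rho> ^ d"
  define \<epsilon> where "\<epsilon> = 4 * real d * sqrt \<eta> + \<mu> * \<eta>"
  have \<mu>: "0 < \<mu>" using \<delta> by simp
  have \<rho>0: "0 < \<rho>" using \<delta> d by (simp add: \<rho>)
  have c0: "0 < c" using \<delta> d \<rho>0 by (simp add: c)
  have n: "0 < n" using L by (simp add: n_def card_lattice)
  \<comment> \<open>With at most 2 d neighbours the remainder is c/4 per neighbour; the factor 2 of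
    \<open>sum_adj_count_le\<close> turns this into c/2, half of the available surface
    energy.\<close>
  define W where "W = 8 * real d / c"
  have W: "0 < W" "2 * real d / W = c / 4" using c0 d by (simp_all add: W_def)
  have r: "0 \<le> ru x" "0 \<le> rd x" for x
    using density_matrix_diag[OF finite_lattice gu] density_matrix_diag[OF finite_lattice gd]
    by (simp_all add: ru_def rd_def)
  have sub: "A \<subseteq> ?\<Lambda>" "B \<subseteq> ?\<Lambda>" by (auto simp: A B)
  have fin: "finite A" "finite B" "finite E" using sub by (auto simp: E_def intro: finite_subset)
  have disj: "A \<inter> B = {}" "A \<inter> E = {}" "B \<inter> E = {}" by (auto simp: A B E_def)
  have part: "?\<Lambda> - A = B \<union> E" "?\<Lambda> - B = A \<union> E" "?\<Lambda> = A \<union> B \<union> E"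
    using sub disj by (auto simp: E_def)
  have E_small: "ru x \<le> \<eta>" "rd x \<le> \<eta>" if "x \<in> E" for x
    using that by (auto simp: E_def A B ru_def rd_def)
  have pen_E: "2 * adj_count d L S y * sqrt r + \<mu> * r \<le> \<epsilon>"
    if "y \<in> E" "S \<subseteq> ?\<Lambda>" "0 \<le> r" "r \<le> \<eta>" for S y r
  proof -
    have "y \<in> ?\<Lambda>" using that(1) by (simp add: E_def)
    note ac = adj_count_bounds[OF L(1) that(2) this]
    have "2 * adj_count d L S y * sqrt r \<le> (2 * (2 * real d)) * sqrt \<eta>"
      using ac that \<eta> by (intro mult_mono) auto
    moreover have "\<mu> * r \<le> \<mu> * \<eta>" using that \<mu> by (intro mult_left_mono) auto
    ultimately show ?thesis unfolding \<epsilon>_def by linarith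
  qed
  \<comment> \<open>Stated for a generic region S with opposite region S', to serve both spin
    species: repulsion pays on S', smallness of the density on E.\<close>
  have leak: "(\<Sum>y\<in>S' \<union> E. 2 * adj_count d L S y * sqrt (f y) + \<mu> * f y)
      \<le> U * (\<Sum>y\<in>S'. f y * g y) + c / 2 * (\<Sum>i<d. bdry d L i S) + \<epsilon> * card E"
    if S: "S \<subseteq> ?\<Lambda>" "?\<Lambda> - S = S' \<union> E" "S' \<inter> E = {}" "finite S'"
      and f: "\<And>x. 0 \<le> f x" "\<And>x. x \<in> E \<Longrightarrow> f x \<le> \<eta>" and g: "\<And>x. x \<in> S' \<Longrightarrow> \<eta> \<le> g x"
    for S S' f g
  proof -
    have ac: "0 \<le> adj_count d L S y" "adj_count d L S y \<le> 2 * real d" if "y \<in> S' \<union> E" for y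
      using adj_count_bounds[OF L(1) S(1), of y] that S(2) by blast+
    have "(\<Sum>y\<in>S' \<union> E. 2 * adj_count d L S y * sqrt (f y) + \<mu> * f y)
      = (\<Sum>y\<in>S'. 2 * adj_count d L S y * sqrt (f y) + \<mu> * f y)
        + (\<Sum>y\<in>E. 2 * adj_count d L S y * sqrt (f y) + \<mu> * f y)"
      using S fin by (intro sum.union_disjoint) auto
    also have "\<dots> \<le> (\<Sum>y\<in>S'. U * (f y * g y) + c / 4 * adj_count d L S y) + (\<Sum>y\<in>E. \<epsilon>)"
    proof (rule add_mono[OF sum_mono sum_mono])
      fix y assume "y \<in> S'"
      then show "2 * adj_count d L S y * sqrt (f y) + \<mu> * f y \<le> U * (f y * g y) + c / 4 * adj_count d L S y"
        using penalty_at_opposite_spin[OF W(1) U(2)[folded W_def] U(1) f(1)[of y] g ac, of y y]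
        by (simp add: W(2))
    next
      fix y assume "y \<in> E"
      then show "2 * adj_count d L S y * sqrt (f y) + \<mu> * f y \<le> \<epsilon>"
        using pen_E S(1) f by blast
    qed
    also have "\<dots> = U * (\<Sum>y\<in>S'. f y * g y) + c / 4 * (\<Sum>y\<in>S'. adj_count d L S y) + \<epsilon> * card E"
      by (simp add: sum.distrib sum_distrib_left)
    also have "(\<Sum>y\<in>S'. adj_count d L S y) \<le> (\<Sum>y\<in>?\<Lambda> - S. adj_count d L S y)"
      unfolding S(2) using S fin ac by (intro sum_mono2) auto
    also have "\<dots> \<le> 2 * (\<Sum>i<d. bdry d L i S)"
      by (rule sum_adj_count_le[OF L(1) S(1)])
    finally show ?thesis using c0 by simp
  qed
  have lu: "(\<Sum>y\<in>?\<Lambda> - A. 2 * adj_count d L A y * sqrt (ru y) + \<mu> * ru y)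
      \<le> U * (\<Sum>y\<in>B. ru y * rd y) + c / 2 * (\<Sum>i<d. bdry d L i A) + \<epsilon> * card E"
    unfolding part(1)
    by (rule leak[OF sub(1) part(1) disj(3) fin(2) r(1) E_small(1)]) (auto simp: B rd_def)
  have ld: "(\<Sum>y\<in>?\<Lambda> - B. 2 * adj_count d L B y * sqrt (rd y) + \<mu> * rd y)
      \<le> U * (\<Sum>y\<in>A. rd y * ru y) + c / 2 * (\<Sum>i<d. bdry d L i B) + \<epsilon> * card E"
    unfolding part(2)
    by (rule leak[OF sub(2) part(2) disj(2) fin(1) r(2) E_small(2)]) (auto simp: A ru_def)
  have su: "card A / n * band_energy d L \<mu> + c * (\<Sum>i<d. bdry d L i A)
      - (\<Sum>y\<in>?\<Lambda> - A. 2 * adj_count d L A y * sqrt (ru y) + \<mu> * ru y)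
      \<le> Re (mtrace ?\<Lambda> (mmul ?\<Lambda> (Kmu d L \<mu>) gu))"
    using energy_one_spin_ge[OF L(1) d \<delta> \<rho> L1 gu sub(1)] by (simp add: n_def ru_def c)
  have sd: "card B / n * band_energy d L \<mu> + c * (\<Sum>i<d. bdry d L i B)
      - (\<Sum>y\<in>?\<Lambda> - B. 2 * adj_count d L B y * sqrt (rd y) + \<mu> * rd y)
      \<le> Re (mtrace ?\<Lambda> (mmul ?\<Lambda> (Kmu d L \<mu>) gd))"
    using energy_one_spin_ge[OF L(1) d \<delta> \<rho> L1 gd sub(2)] by (simp add: n_def rd_def c)
  \<comment> \<open>Spin up draws on the repulsion in B and spin down on that in A; as these are
    disjoint, no interaction energy is spent twice.\<close>
  have UU: "U * (\<Sum>y\<in>B. ru y * rd y) + U * (\<Sum>y\<in>A. rd y * ru y) \<le> U * (\<Sum>x\<in>?\<Lambda>. ru x * rd x)"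
  proof -
    have "(\<Sum>y\<in>B. ru y * rd y) + (\<Sum>y\<in>A. rd y * ru y) = (\<Sum>x\<in>A \<union> B. ru x * rd x)"
      using fin disj by (simp add: sum.union_disjoint mult.commute)
    also have "\<dots> \<le> (\<Sum>x\<in>?\<Lambda>. ru x * rd x)"
      using sub r by (intro sum_mono2) auto
    finally show ?thesis using U(1) by (simp add: mult_left_mono flip: distrib_left)
  qed
  have card: "real (card A) + real (card B) = n - card E"
  proof -
    have "card ?\<Lambda> = card (A \<union> B) + card E"
      using part(3) fin disj by (metis card_Un_disjoint finite_Un Int_Un_distrib2 Un_empty)
    also have "card (A \<union> B) = card A + card B" using fin disj by (intro card_Un_disjoint) auto
    finally show ?thesis by (simp add: n_def)
  qed
  \<comment> \<open>A and B together receive only the fraction (|A| + |B|)/n of the band energy, so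
    each site of E costs at least 2 e0; leakage of the two species into E takes back at most e0 of
    it.\<close>
  have "band_energy d L \<mu> \<le> - (2 * e0 * n)"
    using band_energy_le[OF _ L(2) d \<delta> \<rho> L1] L by (simp add: e0_def n_def)
  then have "band_energy d L \<mu> * (card E / n) \<le> - (2 * e0 * n) * (card E / n)"
    using n by (intro mult_right_mono) auto
  also have "\<dots> = - (2 * e0 * card E)" using n by simp
  finally have bulk: "band_energy d L \<mu> + 2 * e0 * card E
      \<le> card A / n * band_energy d L \<mu> + card B / n * band_energy d L \<mu>"
  proof -
    assume *: "band_energy d L \<mu> * (card E / n) \<le> - (2 * e0 * card E)"
    have "card A / n * band_energy d L \<mu> + card B / n * band_energy d L \<mu>
        = (real (card A) + real (card B)) / n * band_energy d L \<mu>"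
      by (simp add: add_divide_distrib distrib_right)
    also have "\<dots> = band_energy d L \<mu> - band_energy d L \<mu> * (card E / n)"
      unfolding card using n by (simp add: field_simps)
    finally show ?thesis using * by simp
  qed
  have "2 * \<epsilon> * card E \<le> e0 * card E"
    using \<eta>(2) by (intro mult_right_mono) (auto simp: \<epsilon>_def e0_def)
  then have "band_energy d L \<mu> + e0 * card E
      + c / 2 * (\<Sum>i<d. bdry d L i A) + c / 2 * (\<Sum>i<d. bdry d L i B) \<le> hfz d L \<mu> U gu gd"
    unfolding hfz_eq using su sd lu ld UU bulk
    unfolding ru_def[symmetric] rd_def[symmetric] by (simp add: field_simps)
  then show ?thesis by (simp add: e0_def E_def)
qed

text \<open>Against a density of at least \<eta> everywhere, each particle of the other species pays
  at least U \<eta> > \<mu> but gains at most \<mu>; so that species is absent, and uniqueness for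
  one species applies.\<close>

lemma saturated_spin:
  assumes L: "L \<ge> 3" and gu: "density_matrix (lattice d L) gu" and gd: "density_matrix (lattice d L) gd"
    and U: "0 \<le> U" "\<mu> < U * \<eta>" and ru: "\<And>x. x \<in> lattice d L \<Longrightarrow> \<eta> \<le> Re (gu x x)"
    and nz: "\<And>k. k \<in> lattice d L \<Longrightarrow> disp d L k \<noteq> \<mu>"
    and eq: "hfz d L \<mu> U gu gd = band_energy d L \<mu>"
  shows "gu = spec_proj_below (lattice d L) (Kmu d L \<mu>) 0 \<and> gd = (\<lambda>_ _. 0)"
proof -
  let ?\<Lambda> = "lattice d L"
  interpret eigenbasis ?\<Lambda> "pw d L" "Kmu d L \<mu>" "\<lambda>k. disp d L k - \<mu>"
    by (rule eigenbasis_Kmu[OF L])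
  have E0: "E0 = band_energy d L \<mu>" by (simp add: E0_def band_energy_def)
  have rd: "0 \<le> Re (gd x x)" for x by (rule density_matrix_diag(1)[OF finite_lattice gd])
  have "U * \<eta> * (\<Sum>x\<in>?\<Lambda>. Re (gd x x)) \<le> U * (\<Sum>x\<in>?\<Lambda>. Re (gu x x) * Re (gd x x))"
    unfolding mult.assoc sum_distrib_left[of \<eta>]
    using U(1) rd ru by (intro mult_left_mono sum_mono mult_right_mono) auto
  moreover have "- \<mu> * (\<Sum>x\<in>?\<Lambda>. Re (gd x x)) \<le> Re (mtrace ?\<Lambda> (mmul ?\<Lambda> (Kmu d L \<mu>) gd))"
    by (rule energy_ge_density[OF L gd])
  ultimately have "E0 + (U * \<eta> - \<mu>) * (\<Sum>x\<in>?\<Lambda>. Re (gd x x)) \<le> E0"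
    using energy_ge[OF gu] eq unfolding hfz_eq E0 by (simp add: algebra_simps)
  then have "(\<Sum>x\<in>?\<Lambda>. Re (gd x x)) \<le> 0"
    using U(2) by (simp add: mult_le_0_iff)
  then have "(\<Sum>x\<in>?\<Lambda>. Re (gd x x)) = 0"
    using rd by (intro antisym sum_nonneg) auto
  then have "Re (gd x x) = 0" if "x \<in> ?\<Lambda>" for x
    using that rd by (simp add: sum_nonneg_eq_0_iff)
  then have gd0: "gd = (\<lambda>_ _. 0)" by (rule density_matrix_zero_diag[OF finite_lattice gd])
  then have "Re (mtrace ?\<Lambda> (mmul ?\<Lambda> (Kmu d L \<mu>) gu)) = E0"
    using eq by (simp add: hfz_eq E0 mtrace_def mmul_def)
  then have "gu = pbelow 0" using nz by (intro energy_unique[OF gu]) auto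
  then show ?thesis using gd0 by (simp add: spec_proj_below_eq)
qed

theorem theorem1p1:
  fixes d :: nat and \<mu> :: real
  assumes "1 \<le> d" and "0 < \<mu>" and "\<mu> < 4 * real d"
  shows "\<exists>(Lsh :: nat) (Ush :: real). 0 \<le> Ush \<and>
    (\<forall>(L :: nat) (U :: real). even L \<and> Lsh \<le> L \<and> Ush \<le> U \<longrightarrow>
       E_hfz d L \<mu> U = trace_neg (lattice d L) (Kmu d L \<mu>) \<and>
       (\<not> is_eigenvalue (lattice d L) (\<lambda>x y. - laplacian d L x y) \<mu> \<longrightarrow>
         (\<forall>gu gd. density_matrix (lattice d L) gu \<and> density_matrix (lattice d L) gd \<and>
              hfz d L \<mu> U gu gd = E_hfz d L \<mu> U \<longrightarrow>
            (gu = spec_proj_below (lattice d L) (\<lambda>x y. - laplacian d L x y) \<mu> \<and>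
             gd = (\<lambda>_ _. 0)) \<or>
            (gu = (\<lambda>_ _. 0) \<and>
             gd = spec_proj_below (lattice d L) (\<lambda>x y. - laplacian d L x y) \<mu>))))"
proof -
  have d: "0 < d" using assms(1) by simp
  define \<delta> where "\<delta> = min (1 / 2) (min \<mu> (4 * real d - \<mu>))"
  have \<delta>: "0 < \<delta>" "\<delta> \<le> 1 / 2" "\<delta> \<le> \<mu>" "\<delta> \<le> 4 * real d - \<mu>"
    using assms by (auto simp: \<delta>_def min_def)
  define \<rho> where "\<rho> = \<delta> / (16 * pi * real d)"
  have \<rho>0: "0 < \<rho>" using \<delta> d by (simp add: \<rho>_def)
  define c where "c = \<delta> * \<rho> ^ d / (64 * real d)"
  have c0: "0 < c" using \<delta> d \<rho>0 by (simp add: c_def)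
  define e0 where "e0 = \<delta> / 4 * \<rho> ^ d"
  have e0: "0 < e0" using \<delta> \<rho>0 by (simp add: e0_def)
  \<comment> \<open>s plays the role of sqrt \<eta>. The cap at 1 gives \<mu> s^2 <= \<mu> s, which
    makes the condition on \<eta> linear in s.\<close>
  define s where "s = min 1 (e0 / (2 * (4 * real d + \<mu>)))"
  have s: "0 < s" "s \<le> 1" "(4 * real d + \<mu>) * s \<le> e0 / 2"
  proof -
    show "0 < s" "s \<le> 1" using e0 assms by (auto simp: s_def)
    have "(4 * real d + \<mu>) * s \<le> (4 * real d + \<mu>) * (e0 / (2 * (4 * real d + \<mu>)))"
      using assms by (intro mult_left_mono) (auto simp: s_def)
    also have "\<dots> = e0 / 2"
      using assms by (simp add: field_simps)
    finally show "(4 * real d + \<mu>) * s \<le> e0 / 2" .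
  qed
  define \<eta> where "\<eta> = s * s"
  have \<eta>: "0 < \<eta>" "2 * (4 * real d * sqrt \<eta> + \<mu> * \<eta>) \<le> \<delta> / 4 * \<rho> ^ d"
  proof -
    show "0 < \<eta>" using s by (simp add: \<eta>_def)
    have "\<mu> * \<eta> \<le> \<mu> * s" using s assms by (intro mult_left_mono) (auto simp: \<eta>_def mult_left_le)
    then show "2 * (4 * real d * sqrt \<eta> + \<mu> * \<eta>) \<le> \<delta> / 4 * \<rho> ^ d"
      using s by (simp add: \<eta>_def e0_def algebra_simps)
  qed
  define Ush where "Ush = (\<mu> + 8 * real d / c) / \<eta>"
  have Ush: "0 \<le> Ush" using assms c0 \<eta>(1) by (simp add: Ush_def)
  \<comment> \<open>3 keeps neighbours distinct; 1/\<rho> ensures that the momentum box is at least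
    one lattice spacing wide.\<close>
  define Lsh where "Lsh = max 3 (nat \<lceil>1 / \<rho>\<rceil>)"
  show ?thesis
  proof (intro exI[of _ Lsh] exI[of _ Ush] conjI Ush allI impI; (elim conjE)?)
    fix L U assume ev: "even L" and LL: "Lsh \<le> L" and UU: "Ush \<le> U"
    let ?\<Lambda> = "lattice d L"
    have L: "L \<ge> 3" using LL by (simp add: Lsh_def)
    have "1 / \<rho> \<le> real L" using LL by (simp add: Lsh_def)
    then have L1: "1 \<le> \<rho> * real L" using \<rho>0 by (simp add: field_simps)
    have U: "0 \<le> U" "\<mu> + 8 * real d / c \<le> U * \<eta>"
    proof -
      show "0 \<le> U" using UU Ush by linarith
      show "\<mu> + 8 * real d / c \<le> U * \<eta>"
        using UU \<eta>(1) by (simp add: Ush_def pos_divide_le_eq)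
    qed
    have "0 < 8 * real d / c" using c0 d by simp
    then have U\<eta>: "\<mu> < U * \<eta>" using U by linarith
    interpret eigenbasis ?\<Lambda> "pw d L" "Kmu d L \<mu>" "\<lambda>k. disp d L k - \<mu>"
      by (rule eigenbasis_Kmu[OF L])
    have E0: "E0 = band_energy d L \<mu>" by (simp add: E0_def band_energy_def)
    define A where "A gu gd = {x\<in>?\<Lambda>. \<eta> \<le> Re (gu x x) \<and> Re (gd x x) \<le> Re (gu x x)}" for gu gd :: cmat
    define B where "B gu gd = {x\<in>?\<Lambda>. \<eta> \<le> Re (gd x x) \<and> Re (gu x x) < Re (gd x x)}" for gu gd :: cmat
    have bound: "band_energy d L \<mu> + e0 * card (?\<Lambda> - A gu gd - B gu gd)
      + c / 2 * (\<Sum>i<d. bdry d L i (A gu gd)) + c / 2 * (\<Sum>i<d. bdry d L i (B gu gd)) \<le> hfz d L \<mu> U gu gd"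
      if "density_matrix ?\<Lambda> gu" "density_matrix ?\<Lambda> gd" for gu gd
      unfolding e0_def
      by (rule hfz_ge[OF L ev d \<delta> \<rho>_def L1 that c_def \<eta> U A_def[of gu gd] B_def[of gu gd]])
    have nonneg: "0 \<le> c / 2 * (\<Sum>i<d. bdry d L i S)" "0 \<le> e0 * card S" for S
      using c0 e0 by (auto intro!: mult_nonneg_nonneg sum_nonneg bdry_nonneg)
    have zero: "density_matrix ?\<Lambda> (\<lambda>_ _. 0)"
      by (auto simp: density_matrix_iff hermitian_def on_sites_def qf_def ip_def mvec_def sum_nonneg)
    have attained: "hfz d L \<mu> U (pbelow 0) (\<lambda>_ _. 0) = band_energy d L \<mu>"
      using energy_pbelow by (simp add: hfz_eq E0 mtrace_def mmul_def)
    have Ehfz: "E_hfz d L \<mu> U = band_energy d L \<mu>"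
      unfolding E_hfz_def
    proof (rule cInf_eq_minimum)
      show "band_energy d L \<mu> \<in> {hfz d L \<mu> U gu gd |gu gd. density_matrix ?\<Lambda> gu \<and> density_matrix ?\<Lambda> gd}"
        using attained[symmetric] density_matrix_pbelow zero by blast
      fix z assume "z \<in> {hfz d L \<mu> U gu gd |gu gd. density_matrix ?\<Lambda> gu \<and> density_matrix ?\<Lambda> gd}"
      then obtain gu gd where "density_matrix ?\<Lambda> gu" "density_matrix ?\<Lambda> gd" "z = hfz d L \<mu> U gu gd"
        by blast
      then show "band_energy d L \<mu> \<le> z"
        using bound[of gu gd] nonneg(1)[of "A gu gd"] nonneg(1)[of "B gu gd"]
          nonneg(2)[of "?\<Lambda> - A gu gd - B gu gd"] by linarith
    qed
    then show "E_hfz d L \<mu> U = trace_neg ?\<Lambda> (Kmu d L \<mu>)"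
      by (simp add: trace_neg_eq E0)
    fix gu gd
    assume nev: "\<not> is_eigenvalue ?\<Lambda> (\<lambda>x y. - laplacian d L x y) \<mu>"
      and gu: "density_matrix ?\<Lambda> gu" and gd: "density_matrix ?\<Lambda> gd"
      and min: "hfz d L \<mu> U gu gd = E_hfz d L \<mu> U"
    \<comment> \<open>\<open>-\<Delta>\<close> has the same plane waves as eigenbasis, so its
      projection below \<mu> and that of \<open>Kmu d L \<mu>\<close> below 0 are given by the same
      sum.\<close>
    have lap: "(\<lambda>x y. - laplacian d L x y) = Kmu d L 0"
      by (simp add: fun_eq_iff Kmu_def)
    interpret N: eigenbasis ?\<Lambda> "pw d L" "Kmu d L 0" "\<lambda>k. disp d L k - 0"
      by (rule eigenbasis_Kmu[OF L])
    have nz: "disp d L k \<noteq> \<mu>" if "k \<in> ?\<Lambda>" for k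
      using N.eigvec_u[OF that, of 1] nev by (auto simp: lap is_eigenvalue_def)
    have P: "spec_proj_below ?\<Lambda> (Kmu d L \<mu>) 0 = spec_proj_below ?\<Lambda> (\<lambda>x y. - laplacian d L x y) \<mu>"
      unfolding lap spec_proj_below_eq N.spec_proj_below_eq
      by (intro ext) (simp only: pbelow_def N.pbelow_def, simp)
    define S where "S = A gu gd"
    define T where "T = B gu gd"
    have "band_energy d L \<mu> + e0 * card (?\<Lambda> - S - T)
      + c / 2 * (\<Sum>i<d. bdry d L i S) + c / 2 * (\<Sum>i<d. bdry d L i T) \<le> band_energy d L \<mu>"
      using bound[OF gu gd] min Ehfz by (simp add: S_def T_def)
    \<comment> \<open>All excess terms are nonnegative, so the equality of the energies makes them
      vanish one by one.\<close>
    then have "c / 2 * (\<Sum>i<d. bdry d L i S) = 0" and "e0 * card (?\<Lambda> - S - T) = 0"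
      using nonneg(1)[of S] nonneg(1)[of T] nonneg(2)[of "?\<Lambda> - S - T"] by linarith+
    then have "(\<Sum>i<d. bdry d L i S) = 0" and E: "?\<Lambda> - S - T = {}"
      using c0 e0 by auto
    then have "bdry d L i S = 0" if "i < d" for i
      using that by (simp add: sum_nonneg_eq_0_iff bdry_nonneg)
    then have "S = {} \<or> S = ?\<Lambda>"
      using L by (intro bdry_zero) (auto simp: S_def A_def)
    then show "(gu = spec_proj_below ?\<Lambda> (\<lambda>x y. - laplacian d L x y) \<mu> \<and> gd = (\<lambda>_ _. 0)) \<or>
            (gu = (\<lambda>_ _. 0) \<and> gd = spec_proj_below ?\<Lambda> (\<lambda>x y. - laplacian d L x y) \<mu>)"
    proof
      assume "S = ?\<Lambda>"
      then have "\<eta> \<le> Re (gu x x)" if "x \<in> ?\<Lambda>" for x using that by (auto simp: S_def A_def)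
      from saturated_spin[OF L gu gd U(1) U\<eta> this nz] min show ?thesis
        unfolding P Ehfz by blast
    next
      assume "S = {}"
      \<comment> \<open>With S empty and no undecided site left, spin down dominates everywhere;
        symmetry of the functional under exchange of the spins gives the second alternative.\<close>
      then have "?\<Lambda> \<subseteq> T" using E by auto
      then have "\<eta> \<le> Re (gd x x)" if "x \<in> ?\<Lambda>" for x using that by (auto simp: T_def B_def)
      from saturated_spin[OF L gd gu U(1) U\<eta> this nz] min show ?thesis
        unfolding P Ehfz hfz_commute[of d L \<mu> U gu gd] by blast
    qed
  qed
qed

end
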